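(* Let $0<q\le1$ and $R_q>0$, let $n\ge 1$, $p\ge2$ be integers, $T>0$, and let $D\in\mathbb{R}^{p\times p}$ be an orthonormal matrix with first column $p^{-1/2}\mathbbm{1}_{p\times1}$ and remaining columns $\bar D=[d_2,\dots,d_p]\in\mathbb{R}^{p\times(p-1)}$. Let $f^*\in\mathcal{F}_{p,q,D}$, let $y\sim\text{Poisson}(TAf^* )$, and assume $T>2n\log p$. Let $\tilde K\ge1$ be an integer of order $R_q(\frac{\log p}{T})^{-q/2}$, and assume: (1) there are constants $a_\ell<a_u$ and a matrix $\tilde A\in[a_\ell/\sqrt n,a_u/\sqrt n]^{n\times p}$ such that $A=\dfrac{\tilde A+\frac{a_u-2a_\ell}{\sqrt n}\mathbbm{1}_{n\times p}}{2(a_u-a_\ell)\sqrt n}$; (2) there is $\delta_{\tilde K}\in(0,1)$ such that $\|\tilde ADu\|_2^2\le(1+\delta_{\tilde K})\|u\|_2^2$ for all $u\in\mathbb{R}^p$ with $\|u\|_0\le2\tilde K$; (3) there is a constant $c_0>0$ such that $n\ge c_0\tilde K\log p$; (4) there are strictly positive constants $k_1,k_2$ depending on $a_u,a_\ell$ such that $\sqrt n\|A\bar Dx\|_2\ge k_1\|x\|_2-k_2\sqrt{\frac{\log p}{n}}\|x\|_1$ for all $x\in\mathbb{R}^{p-1}$. Put $M=\frac{1+\delta_{\tilde K}}{4(a_u-a_\ell)^2}$ and $\lambda_n=2\sqrt{\frac{32M\log p}{T}}$, let $$\hat\theta_{\lambda_n}\in\arg\min_{\theta\in\mathbb{R}^p,\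 \theta_1=1/\sqrt p}\ \frac{n}{T^2}\|y-TAD\theta\|_2^2+\lambda_n\|\theta\|_1,$$ and $\hat f_{\lambda_n}=D\hat\theta_{\lambda_n}$. Then there exists a constant $C_U>0$ depending on $a_u,a_\ell,\delta_{\tilde K}$ (with $q$, $c_0$ and the implicit constants in the order of $\tilde K$ regarded as fixed) such that $$\|\hat f_{\lambda_n}-f^*\|_2^2\le C_UR_q\Big(\frac{\log p}{T}\Big)^{1-\frac q2}$$ with probability at least $1-\frac{2}{p-1}$.
   Context: $\mathbbm{1}_{a\times b}$ is the all-ones $a\times b$ matrix; $\|u\|_0$ is the number of nonzero entries of $u$; $\|u\|_q^q=\sum_j|u_j|^q$. $\mathcal{F}_{p,q,D}=\{f\in\mathbb{R}^p_+ : \|f\|_1=1,\ \|\bar D^\top f\|_q^q\le R_q\}$. $y\sim\text{Poisson}(\mu)$ for $\mu\in\mathbb{R}^n_+$ means $y_1,\dots,y_n$ are independent with $y_i\sim\text{Poisson}(\mu_i)$. $A$ and $T$ are known and deterministic; the probability is over $y$. "$\tilde K$ is of order $R_q(\frac{\log p}{T})^{-q/2}$" means $c_KR_q(\frac{\log p}{T})^{-q/2}\le\tilde K\le C_KR_q(\frac{\log p}{T})^{-q/2}$ for fixed positive constants $c_K,C_K$; in particular assumption (3) is, up to constants, the condition $n\ge c\,R_q(\frac{\log p}{T})^{-q/2}\log p$ for a fixed constant $c>0$. *)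

theory Defs
  imports
    "HOL-Analysis.L2_Norm"
    "HOL-Probability.Product_PMF"
    "Jordan_Normal_Form.Matrix"
begin

unbundle no vec_syntax

text \<open>
  The dimensions \<open>n\<close> and \<open>p\<close> are quantified inside the statement (the constant of the bound has
  to be uniform in them), so vectors and matrices have explicit carriers.
  Indices start at \<open>0\<close>: the first column of \<open>D\<close> is \<open>col D 0\<close>, the first entry of \<open>\<theta>\<close> is
  \<open>\<theta> $ 0\<close>.
\<close>

definition l0_norm :: "real vec \<Rightarrow> nat" where
  "l0_norm u = card {j. j < dim_vec u \<and> u $ j \<noteq> 0}"

definition l1_norm :: "real vec \<Rightarrow> real" where
  "l1_norm u = (\<Sum>j<dim_vec u. \<bar>u $ j\<bar>)"

definition l2_norm :: "real vec \<Rightarrow> real" where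
  "l2_norm u = L2_set (\<lambda>j. u $ j) {..<dim_vec u}"

text \<open>The \<open>q\<close>-th power of the \<open>q\<close>-(quasi)norm, for \<open>q > 0\<close>; note that \<open>0 powr q = 0\<close>.\<close>

definition lq_norm_pow :: "real \<Rightarrow> real vec \<Rightarrow> real" where
  "lq_norm_pow q u = (\<Sum>j<dim_vec u. \<bar>u $ j\<bar> powr q)"

definition orthonormal_mat :: "nat \<Rightarrow> real mat \<Rightarrow> bool" where
  "orthonormal_mat p D \<longleftrightarrow> D \<in> carrier_mat p p \<and> transpose_mat D * D = 1\<^sub>m p"

definition ones_mat :: "nat \<Rightarrow> nat \<Rightarrow> real mat" where
  "ones_mat a b = mat a b (\<lambda>_. 1)"

text \<open>\<open>D_bar D\<close> is \<open>D\<close> without its first column.\<close>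

definition D_bar :: "real mat \<Rightarrow> real mat" where
  "D_bar D = mat (dim_row D) (dim_col D - 1) (\<lambda>(i, j). D $$ (i, Suc j))"

definition F_class :: "nat \<Rightarrow> real \<Rightarrow> real mat \<Rightarrow> real \<Rightarrow> real vec set" where
  "F_class p q D R = {f \<in> carrier_vec p.
     (\<forall>j<p. 0 \<le> f $ j) \<and> l1_norm f = 1 \<and> lq_norm_pow q (transpose_mat (D_bar D) *\<^sub>v f) \<le> R}"

text \<open>
  Law of a vector with independent entries \<open>y\<^sub>i \<sim> Poisson(\<mu>\<^sub>i)\<close>, \<open>\<mu>\<^sub>i \<ge> 0\<close>.  The constant
  \<^const>\<open>poisson_pmf\<close> is unspecified at rate \<open>0\<close>, where the Poisson law is the point mass at \<open>0\<close>.
\<close>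

definition poisson_law :: "real \<Rightarrow> nat pmf" where
  "poisson_law r = (if r = 0 then return_pmf 0 else poisson_pmf r)"

definition poisson_vec :: "real vec \<Rightarrow> real vec pmf" where
  "poisson_vec \<mu> =
     map_pmf (\<lambda>k. vec (dim_vec \<mu>) (\<lambda>i. real (k i)))
       (Pi_pmf {..<dim_vec \<mu>} 0 (\<lambda>i. poisson_law (\<mu> $ i)))"

definition lasso_objective ::
  "nat \<Rightarrow> real \<Rightarrow> real mat \<Rightarrow> real mat \<Rightarrow> real \<Rightarrow> real vec \<Rightarrow> real vec \<Rightarrow> real" where
  "lasso_objective n T A D lam y \<theta> =
     real n / T^2 * (l2_norm (y - (T \<cdot>\<^sub>m (A * D)) *\<^sub>v \<theta>))^2 + lam * l1_norm \<theta>"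

definition is_lasso_estimate ::
  "nat \<Rightarrow> nat \<Rightarrow> real \<Rightarrow> real mat \<Rightarrow> real mat \<Rightarrow> real \<Rightarrow> real vec \<Rightarrow> real vec \<Rightarrow> bool" where
  "is_lasso_estimate n p T A D lam y \<theta> \<longleftrightarrow>
     is_arg_min (lasso_objective n T A D lam y)
       (\<lambda>\<theta>. \<theta> \<in> carrier_vec p \<and> \<theta> $ 0 = 1 / sqrt (real p)) \<theta>"

end

theory Submission
  imports Defs "Jordan_Normal_Form.Determinant"
begin

text \<open>
  Let \<open>t = D\<^sup>T f\<^sup>*\<close>, \<open>d\<close> the error of the lasso estimate of \<open>t\<close> and \<open>e = log p / T\<close>. The columns of
  \<open>D\<close> other than the first are orthogonal to the constants, so those columns of \<open>A D\<close> are rescaled columns of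
  \<open>A' D\<close>, of squared length at most \<open>M / n\<close>. All rates are at most \<open>T / n\<close>; the Chernoff bound for
  independent Poisson variables, with \<open>T > 2 n log p\<close> keeping the exponent in the quadratic regime,
  and a union bound show that with the required probability the inner products of the noise \<open>y - T A f\<^sup>*\<close>
  with those columns are at most \<open>T \<lambda>\<^sub>n / (4 n)\<close>. On this event the optimality of the estimate gives
  \<open>n \<parallel>A D d\<parallel>\<^sub>2\<^sup>2 \<le> \<lambda>\<^sub>n/2 \<parallel>d\<parallel>\<^sub>1 + \<lambda>\<^sub>n (\<parallel>t\<parallel>\<^sub>1 - \<parallel>t + d\<parallel>\<^sub>1)\<close>. Let \<open>S\<close> be the set of coordinates with
  \<open>\<bar>t\<^sub>j\<bar> > \<tau>\<close>, where \<open>\<tau>\<close> is a large constant times \<open>\<surd>e\<close>. Then \<open>\<parallel>d\<parallel>\<^sub>1\<close> is at most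
  \<open>4 \<surd>\<bar>S\<bar> \<parallel>d\<parallel>\<^sub>2\<close> plus a multiple of the \<open>\<ell>\<^sub>1\<close> mass of \<open>t\<close> outside \<open>S\<close>, and the curvature assumption turns the
  basic inequality into a quadratic inequality for \<open>\<parallel>d\<parallel>\<^sub>2\<close>.
\<close>

section \<open>Concentration of weighted Poisson sums\<close>

text \<open>The library bound settles \<open>x\<close> at least \<open>0\<close>. For
  \<open>x = - u\<close>, the product \<open>(1 - u + u\<^sup>2) * (1 + u + u\<^sup>2 / 2)\<close>
  has no linear term and is at least \<open>1\<close>, so \<open>1 - u + u\<^sup>2\<close> dominates
  \<open>1 / exp u\<close>. Both signs are needed because the weights of the Poisson sums may be
  negative.\<close>

lemma exp_le_quadratic:
  fixes x :: real
  assumes "\<bar>x\<bar> \<le> 1"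
  shows "exp x \<le> 1 + x + x\<^sup>2"
proof (cases "0 \<le> x")
  case True
  then show ?thesis using exp_bound[of x] assms by simp
next
  case False
  define u where "u = - x"
  have u: "0 \<le> u" using False by (simp add: u_def)
  have pos: "0 < 1 - u + u\<^sup>2"
    using zero_le_power2[of "u - 1 / 2"] by (simp add: power2_eq_square field_simps)
  have "1 \<le> 1 + u\<^sup>2 / 2 + u ^ 3 / 2 + u ^ 4 / 2" using u by simp
  also have "\<dots> = (1 - u + u\<^sup>2) * (1 + u + u\<^sup>2 / 2)"
    by (simp add: field_simps power2_eq_square power3_eq_cube power4_eq_xxxx)
  also have "\<dots> \<le> (1 - u + u\<^sup>2) * exp u"
    using exp_lower_Taylor_quadratic[OF u] pos by (intro mult_left_mono) auto
  finally have "exp (- u) \<le> 1 - u + u\<^sup>2"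
    by (simp add: exp_minus inverse_eq_divide divide_le_eq)
  then show ?thesis by (simp add: u_def)
qed

text \<open>Centred exponential moment, by summing the exponential series at
  \<open>r * exp a\<close>. With the nonnegative integral there is no integrability to
  check.\<close>

lemma nn_integral_exp_poisson_pmf:
  assumes "0 < r"
  shows "(\<integral>\<^sup>+k. ennreal (exp (a * (real k - r))) \<partial>poisson_pmf r) = ennreal (exp (r * (exp a - 1 - a)))"
proof -
  have "(\<integral>\<^sup>+k. ennreal (exp (a * (real k - r))) \<partial>poisson_pmf r) =
      (\<integral>\<^sup>+k. ennreal (pmf (poisson_pmf r) k) * ennreal (exp (a * (real k - r))) \<partial>count_space UNIV)"
    by (rule nn_integral_measure_pmf)
  also have "\<dots> = (\<integral>\<^sup>+k. ennreal (exp (- r - a * r) * ((r * exp a) ^ k / fact k)) \<partial>count_space UNIV)"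
  proof (intro nn_integral_cong)
    fix k :: nat
    have "exp (a * (real k - r)) = exp (- (a * r)) * exp a ^ k"
      by (simp add: exp_of_nat_mult[symmetric] exp_add[symmetric] algebra_simps)
    moreover have "exp (- r - a * r) = exp (- r) * exp (- (a * r))"
      by (simp add: exp_add[symmetric])
    ultimately show "ennreal (pmf (poisson_pmf r) k) * ennreal (exp (a * (real k - r))) =
        ennreal (exp (- r - a * r) * ((r * exp a) ^ k / fact k))"
      using assms by (simp add: ennreal_mult'[symmetric] power_mult_distrib mult_ac)
  qed
  also have "\<dots> = (\<Sum>k. ennreal (exp (- r - a * r) * ((r * exp a) ^ k / fact k)))"
    by (rule nn_integral_count_space_nat)
  also have "\<dots> = ennreal (exp (- r - a * r) * exp (r * exp a))"
  proof (rule suminf_ennreal_eq)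
    show "(\<lambda>k. exp (- r - a * r) * ((r * exp a) ^ k / fact k)) sums (exp (- r - a * r) * exp (r * exp a))"
      using exp_converges[of "r * exp a"] by (intro sums_mult) (simp add: divide_inverse mult.commute)
  qed (use assms in simp)
  also have "exp (- r - a * r) * exp (r * exp a) = exp (r * (exp a - 1 - a))"
    by (simp add: exp_add[symmetric] algebra_simps)
  finally show ?thesis .
qed

text \<open>Chernoff bound with variance proxy \<open>V\<close>. Independence factorises the
  exponential moment, and \<open>exp_le_quadratic\<close> bounds its logarithm by
  \<open>s\<^sup>2 * V\<close>. Hypothesis \<open>bd\<close> says exactly that the optimal
  \<open>s\<close> keeps every exponent \<open>s * v i\<close> in \<open>[-1, 1]\<close>.\<close>

lemma poisson_upper_tail:
  fixes \<mu> v :: "'a \<Rightarrow> real"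
  assumes fin: "finite I" and \<mu>: "\<And>i. i \<in> I \<Longrightarrow> 0 < \<mu> i"
    and var: "(\<Sum>i\<in>I. \<mu> i * (v i)\<^sup>2) \<le> V" and V: "0 < V" and t: "0 \<le> t"
    and bd: "\<And>i. i \<in> I \<Longrightarrow> t * \<bar>v i\<bar> \<le> 2 * V"
  shows "measure_pmf.prob (Pi_pmf I d (\<lambda>i. poisson_pmf (\<mu> i)))
           {k. t \<le> (\<Sum>i\<in>I. v i * (real (k i) - \<mu> i))} \<le> exp (- t\<^sup>2 / (4 * V))"
proof -
  \<comment> \<open>The minimiser of \<open>s\<^sup>2 * V - s * t\<close>, where the minimum is
    \<open>- t\<^sup>2 / (4 * V)\<close>.\<close>
  define s where "s = t / (2 * V)"
  let ?P = "Pi_pmf I d (\<lambda>i. poisson_pmf (\<mu> i))"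
  let ?X = "\<lambda>k. \<Sum>i\<in>I. v i * (real (k i) - \<mu> i)"
  have s: "0 \<le> s" using t V by (simp add: s_def)
  have sv: "\<bar>s * v i\<bar> \<le> 1" if "i \<in> I" for i
    using bd[OF that] t V by (simp add: s_def abs_mult)
  have mgf: "(\<integral>\<^sup>+k. ennreal (exp (s * ?X k)) \<partial>?P) \<le> ennreal (exp (s\<^sup>2 * V))"
  proof -
    have "(\<integral>\<^sup>+k. ennreal (exp (s * ?X k)) \<partial>?P) =
        (\<integral>\<^sup>+k. (\<Prod>i\<in>I. ennreal (exp (s * v i * (real (k i) - \<mu> i)))) \<partial>?P)"
      by (intro nn_integral_cong)
        (simp add: prod_ennreal exp_sum[OF fin, symmetric] sum_distrib_left mult.assoc)
    also have "\<dots> = (\<Prod>i\<in>I. \<integral>\<^sup>+k. ennreal (exp (s * v i * (real k - \<mu> i))) \<partial>poisson_pmf (\<mu> i))"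
      by (rule nn_integral_prod_Pi_pmf[OF fin])
    also have "\<dots> = (\<Prod>i\<in>I. ennreal (exp (\<mu> i * (exp (s * v i) - 1 - s * v i))))"
      by (intro prod.cong refl nn_integral_exp_poisson_pmf \<mu>)
    also have "\<dots> = ennreal (exp (\<Sum>i\<in>I. \<mu> i * (exp (s * v i) - 1 - s * v i)))"
      by (simp add: prod_ennreal exp_sum[OF fin])
    also have "\<dots> \<le> ennreal (exp (\<Sum>i\<in>I. \<mu> i * (s * v i)\<^sup>2))"
    proof (intro ennreal_leI, subst exp_le_cancel_iff, intro sum_mono mult_left_mono)
      fix i assume i: "i \<in> I"
      show "exp (s * v i) - 1 - s * v i \<le> (s * v i)\<^sup>2"
        using exp_le_quadratic[OF sv[OF i]] by simp
      show "0 \<le> \<mu> i" using \<mu>[OF i] by simp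
    qed
    also have "(\<Sum>i\<in>I. \<mu> i * (s * v i)\<^sup>2) = s\<^sup>2 * (\<Sum>i\<in>I. \<mu> i * (v i)\<^sup>2)"
      by (simp add: sum_distrib_left power_mult_distrib mult_ac)
    also have "ennreal (exp \<dots>) \<le> ennreal (exp (s\<^sup>2 * V))"
      using var by (intro ennreal_leI) (simp add: mult_left_mono)
    finally show ?thesis .
  qed
  have "emeasure ?P {k. t \<le> ?X k} \<le> emeasure ?P ({k\<in>UNIV. 1 \<le> ennreal (exp (- s * t)) * ennreal (exp (s * ?X k))})"
  proof (intro emeasure_mono subsetI)
    fix k assume "k \<in> {k. t \<le> ?X k}"
    then have "s * t \<le> s * ?X k" using s by (simp add: mult_left_mono)
    then have "1 \<le> exp (- s * t) * exp (s * ?X k)"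
      by (simp add: exp_add[symmetric])
    then show "k \<in> {k\<in>UNIV. 1 \<le> ennreal (exp (- s * t)) * ennreal (exp (s * ?X k))}"
      by (simp add: ennreal_mult'[symmetric])
  qed simp
  also have "\<dots> \<le> ennreal (exp (- s * t)) * (\<integral>\<^sup>+k. ennreal (exp (s * ?X k)) * indicator UNIV k \<partial>?P)"
    by (rule nn_integral_Markov_inequality) simp_all
  also have "\<dots> \<le> ennreal (exp (- s * t)) * ennreal (exp (s\<^sup>2 * V))"
    using mgf by (intro mult_left_mono) auto
  also have "\<dots> = ennreal (exp (s\<^sup>2 * V - s * t))"
    by (simp add: ennreal_mult'[symmetric] exp_add[symmetric])
  also have "s\<^sup>2 * V - s * t = - t\<^sup>2 / (4 * V)"
    using V by (simp add: s_def field_simps power2_eq_square)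
  finally show ?thesis
    by (simp add: measure_pmf.emeasure_eq_measure)
qed

lemma poisson_two_sided_tail:
  fixes \<mu> v :: "'a \<Rightarrow> real"
  assumes "finite I" and "\<And>i. i \<in> I \<Longrightarrow> 0 < \<mu> i"
    and "(\<Sum>i\<in>I. \<mu> i * (v i)\<^sup>2) \<le> V" and "0 < V" and "0 \<le> t"
    and "\<And>i. i \<in> I \<Longrightarrow> t * \<bar>v i\<bar> \<le> 2 * V"
  shows "measure_pmf.prob (Pi_pmf I d (\<lambda>i. poisson_pmf (\<mu> i)))
           {k. t \<le> \<bar>\<Sum>i\<in>I. v i * (real (k i) - \<mu> i)\<bar>} \<le> 2 * exp (- t\<^sup>2 / (4 * V))"
proof -
  let ?P = "Pi_pmf I d (\<lambda>i. poisson_pmf (\<mu> i))"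
  let ?X = "\<lambda>v k. \<Sum>i\<in>I. v i * (real (k i) - \<mu> i)"
  have neg: "?X (\<lambda>i. - v i) k = - ?X v k" for k
    by (simp add: sum_negf)
  have split: "{k. t \<le> \<bar>?X v k\<bar>} = {k. t \<le> ?X v k} \<union> {k. t \<le> ?X (\<lambda>i. - v i) k}"
    unfolding neg by auto
  have "measure_pmf.prob ?P {k. t \<le> \<bar>?X v k\<bar>} \<le>
      measure_pmf.prob ?P {k. t \<le> ?X v k} + measure_pmf.prob ?P {k. t \<le> ?X (\<lambda>i. - v i) k}"
    unfolding split by (rule measure_Un_le) simp_all
  also have "\<dots> \<le> exp (- t\<^sup>2 / (4 * V)) + exp (- t\<^sup>2 / (4 * V))"
    by (intro add_mono poisson_upper_tail) (use assms in auto)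
  finally show ?thesis by simp
qed

lemma poisson_vec_union_tail:
  fixes B :: "nat \<Rightarrow> 'a \<Rightarrow> real"
  assumes J: "finite J" and \<mu>: "\<And>i. i < dim_vec \<mu> \<Longrightarrow> 0 < \<mu> $ i"
    and var: "\<And>j. j \<in> J \<Longrightarrow> (\<Sum>i<dim_vec \<mu>. \<mu> $ i * (B i j)\<^sup>2) \<le> V"
    and V: "0 < V" and t: "0 \<le> t"
    and bd: "\<And>i j. i < dim_vec \<mu> \<Longrightarrow> j \<in> J \<Longrightarrow> t * \<bar>B i j\<bar> \<le> 2 * V"
  shows "measure_pmf.prob (poisson_vec \<mu>)
           {y. \<exists>j\<in>J. t \<le> \<bar>\<Sum>i<dim_vec \<mu>. B i j * (y $ i - \<mu> $ i)\<bar>}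
         \<le> real (card J) * (2 * exp (- t\<^sup>2 / (4 * V)))"
proof -
  let ?n = "dim_vec \<mu>"
  let ?P = "Pi_pmf {..<?n} 0 (\<lambda>i. poisson_pmf (\<mu> $ i))"
  \<comment> \<open>Positive rates exclude the point-mass branch of \<open>poisson_law\<close>, so
    the tail bounds for \<open>poisson_pmf\<close> apply in each coordinate.\<close>
  have P: "poisson_vec \<mu> = map_pmf (\<lambda>k. vec ?n (\<lambda>i. real (k i))) ?P"
    unfolding poisson_vec_def
    by (intro arg_cong[where f = "map_pmf _"] Pi_pmf_cong) (use \<mu> in \<open>force simp: poisson_law_def\<close>)+
  have "measure_pmf.prob (poisson_vec \<mu>) {y. \<exists>j\<in>J. t \<le> \<bar>\<Sum>i<?n. B i j * (y $ i - \<mu> $ i)\<bar>}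
      = measure_pmf.prob ?P (\<Union>j\<in>J. {k. t \<le> \<bar>\<Sum>i<?n. B i j * (real (k i) - \<mu> $ i)\<bar>})"
    unfolding P measure_map_pmf by (intro arg_cong[where f = "measure_pmf.prob ?P"]) auto
  also have "\<dots> \<le> (\<Sum>j\<in>J. measure_pmf.prob ?P {k. t \<le> \<bar>\<Sum>i<?n. B i j * (real (k i) - \<mu> $ i)\<bar>})"
    by (intro measure_pmf.finite_measure_subadditive_finite J) simp
  also have "\<dots> \<le> (\<Sum>j\<in>J. 2 * exp (- t\<^sup>2 / (4 * V)))"
    by (intro sum_mono poisson_two_sided_tail) (use \<mu> var V t bd in auto)
  finally show ?thesis by simp
qed

section \<open>Lasso error under weak sparsity\<close>

text \<open>Markov's inequality for counting measure: each counted coordinate contributes at least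
  \<open>\<tau> powr q\<close> to a sum bounded by \<open>R\<close>.\<close>

lemma weak_sparsity_support:
  fixes t :: "'a \<Rightarrow> real"
  assumes fin: "finite J" and \<tau>: "0 < \<tau>" and q: "0 < q"
    and sparse: "(\<Sum>j\<in>J. \<bar>t j\<bar> powr q) \<le> R"
  shows "real (card {j\<in>J. \<tau> < \<bar>t j\<bar>}) \<le> R * \<tau> powr (- q)"
proof -
  let ?S = "{j\<in>J. \<tau> < \<bar>t j\<bar>}"
  have "real (card ?S) * \<tau> powr q = (\<Sum>j\<in>?S. \<tau> powr q)" by simp
  also have "\<dots> \<le> (\<Sum>j\<in>?S. \<bar>t j\<bar> powr q)"
    using \<tau> q by (intro sum_mono powr_mono2) auto
  also have "\<dots> \<le> (\<Sum>j\<in>J. \<bar>t j\<bar> powr q)"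
    using fin by (intro sum_mono2) auto
  finally have "real (card ?S) * \<tau> powr q \<le> R" using sparse by simp
  then show ?thesis using \<tau> by (simp add: powr_minus field_simps)
qed

text \<open>A coordinate of size at most \<tau> satisfies \<open>\<bar>t j\<bar> = \<bar>t j\<bar>
  powr q * \<bar>t j\<bar> powr (1 - q)\<close>, and the second factor is at most
  \<open>\<tau> powr (1 - q)\<close> because \<open>q\<close> is at most \<open>1\<close>.\<close>

lemma weak_sparsity_tail:
  fixes t :: "'a \<Rightarrow> real"
  assumes fin: "finite J" and \<tau>: "0 < \<tau>" and q: "q \<le> 1"
    and sparse: "(\<Sum>j\<in>J. \<bar>t j\<bar> powr q) \<le> R"
  shows "(\<Sum>j\<in>J - {j\<in>J. \<tau> < \<bar>t j\<bar>}. \<bar>t j\<bar>) \<le> R * \<tau> powr (1 - q)"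
proof -
  let ?U = "J - {j\<in>J. \<tau> < \<bar>t j\<bar>}"
  have "(\<Sum>j\<in>?U. \<bar>t j\<bar>) \<le> (\<Sum>j\<in>?U. \<bar>t j\<bar> powr q * \<tau> powr (1 - q))"
  proof (rule sum_mono)
    fix j assume j: "j \<in> ?U"
    show "\<bar>t j\<bar> \<le> \<bar>t j\<bar> powr q * \<tau> powr (1 - q)"
    proof (cases "t j = 0")
      case False
      then have "\<bar>t j\<bar> = \<bar>t j\<bar> powr q * \<bar>t j\<bar> powr (1 - q)"
        by (simp add: powr_add[symmetric])
      also have "\<dots> \<le> \<bar>t j\<bar> powr q * \<tau> powr (1 - q)"
        using j q by (intro mult_left_mono powr_mono2) auto
      finally show ?thesis .
    qed simp
  qed
  also have "\<dots> = (\<Sum>j\<in>?U. \<bar>t j\<bar> powr q) * \<tau> powr (1 - q)"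
    by (simp add: sum_distrib_right)
  also have "(\<Sum>j\<in>?U. \<bar>t j\<bar> powr q) \<le> R"
    using sum_mono2[OF fin, of ?U "\<lambda>j. \<bar>t j\<bar> powr q"] sparse by auto
  finally show ?thesis by (simp add: mult_right_mono)
qed

text \<open>Two uses of the triangle inequality: \<open>\<bar>t\<bar> - \<bar>t + d\<bar>\<close> is
  at most \<open>\<bar>d\<bar>\<close>, used on \<open>S\<close>, and at most
  \<open>2 * \<bar>t\<bar> - \<bar>d\<bar>\<close>, used off \<open>S\<close>. The negative term off
  \<open>S\<close> is what controls the error there.\<close>

lemma l1_penalty_decrease:
  fixes t d :: "'a \<Rightarrow> real"
  assumes fin: "finite J" and S: "S \<subseteq> J"
  shows "(\<Sum>j\<in>J. \<bar>t j\<bar>) - (\<Sum>j\<in>J. \<bar>t j + d j\<bar>)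
    \<le> (\<Sum>j\<in>S. \<bar>d j\<bar>) - (\<Sum>j\<in>J - S. \<bar>d j\<bar>) + 2 * (\<Sum>j\<in>J - S. \<bar>t j\<bar>)"
proof -
  have split: "sum g J = sum g S + sum g (J - S)" for g :: "'a \<Rightarrow> real"
    using sum.subset_diff[OF S fin, of g] by simp
  have "(\<Sum>j\<in>S. \<bar>t j\<bar> - \<bar>t j + d j\<bar>) \<le> (\<Sum>j\<in>S. \<bar>d j\<bar>)"
    by (intro sum_mono) auto
  moreover have "(\<Sum>j\<in>J - S. \<bar>t j\<bar> - \<bar>t j + d j\<bar>) \<le> (\<Sum>j\<in>J - S. 2 * \<bar>t j\<bar> - \<bar>d j\<bar>)"
    by (intro sum_mono) auto
  ultimately show ?thesis
    unfolding split[of "\<lambda>j. \<bar>t j\<bar>"] split[of "\<lambda>j. \<bar>t j + d j\<bar>"]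
    by (simp add: sum_subtractf sum_distrib_left)
qed

lemma quadratic_inequality_bound:
  fixes x :: real
  assumes a: "0 < a" and le: "a * x\<^sup>2 \<le> b * x + c"
  shows "x\<^sup>2 \<le> b\<^sup>2 / a\<^sup>2 + 2 * c / a"
proof -
  have "0 \<le> (a * x - b)\<^sup>2" by simp
  then have "2 * a * (b * x) \<le> a\<^sup>2 * x\<^sup>2 + b\<^sup>2"
    by (simp add: power2_eq_square algebra_simps)
  moreover have "2 * a * (a * x\<^sup>2) \<le> 2 * a * (b * x + c)"
    using mult_left_mono[OF le, of "2 * a"] a by simp
  ultimately have "a\<^sup>2 * x\<^sup>2 \<le> b\<^sup>2 + 2 * a * c"
    by (simp add: power2_eq_square algebra_simps)
  then have "x\<^sup>2 \<le> (b\<^sup>2 + 2 * a * c) / a\<^sup>2"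
    using a by (simp add: field_simps)
  also have "\<dots> = b\<^sup>2 / a\<^sup>2 + 2 * c / a"
    using a by (simp add: field_simps power2_eq_square)
  finally show ?thesis .
qed

text \<open>Deterministic core. \<open>G\<close> stands for the scaled prediction error, \<kappa>
  for the coefficient of the l1 term in the curvature bound. The first summand of the conclusion
  covers the case where the l1 mass below the threshold dominates; the other two solve the quadratic
  inequality of the opposite case.\<close>

lemma lasso_error_bound:
  fixes t d :: "'a \<Rightarrow> real"
  assumes fin: "finite J" and q: "0 < q" "q \<le> 1" and \<tau>: "0 < \<tau>"
    and lam: "0 < lam" and \<kappa>: "0 \<le> \<kappa>" and k: "0 < k" and G: "0 \<le> G"
    and sparse: "(\<Sum>j\<in>J. \<bar>t j\<bar> powr q) \<le> R"
    and basic: "G\<^sup>2 \<le> lam / 2 * (\<Sum>j\<in>J. \<bar>d j\<bar>) + lam * ((\<Sum>j\<in>J. \<bar>t j\<bar>) - (\<Sum>j\<in>J. \<bar>t j + d j\<bar>))"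
    and curv: "k * L2_set d J - \<kappa> * (\<Sum>j\<in>J. \<bar>d j\<bar>) \<le> G"
    and small: "8 * \<kappa> * sqrt (R * \<tau> powr (- q)) \<le> k"
  shows "(L2_set d J)\<^sup>2 \<le> (16 * \<kappa> / k)\<^sup>2 * (R * \<tau> powr (1 - q))\<^sup>2
    + 576 * lam\<^sup>2 * (R * \<tau> powr (- q)) / k ^ 4 + 64 * lam * (R * \<tau> powr (1 - q)) / k\<^sup>2"
proof -
  define S where "S = {j\<in>J. \<tau> < \<bar>t j\<bar>}"
  define s where "s = R * \<tau> powr (- q)"
  define r where "r = R * \<tau> powr (1 - q)"
  define x where "x = L2_set d J"
  define dS where "dS = (\<Sum>j\<in>S. \<bar>d j\<bar>)"
  define dU where "dU = (\<Sum>j\<in>J - S. \<bar>d j\<bar>)"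
  have SJ: "S \<subseteq> J" by (auto simp: S_def)
  have cardS: "real (card S) \<le> s"
    using weak_sparsity_support[OF fin \<tau> q(1) sparse] by (simp add: S_def s_def)
  have tail: "(\<Sum>j\<in>J - S. \<bar>t j\<bar>) \<le> r"
    using weak_sparsity_tail[OF fin \<tau> q(2) sparse] by (simp add: S_def r_def)
  have r: "0 \<le> r" using tail by (meson order_trans sum_nonneg abs_ge_zero)
  have s: "0 \<le> s" using cardS by linarith
  have x: "0 \<le> x" by (simp add: x_def)
  have dU: "0 \<le> dU" by (simp add: dU_def sum_nonneg)
  have dJ: "(\<Sum>j\<in>J. \<bar>d j\<bar>) = dS + dU"
    using sum.subset_diff[OF SJ fin, of "\<lambda>j. \<bar>d j\<bar>"] by (simp add: dS_def dU_def)
  have "dS \<le> L2_set d S * L2_set (\<lambda>_. 1) S"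
    using L2_set_mult_ineq[of d "\<lambda>_. 1" S] by (simp add: dS_def)
  also have "\<dots> \<le> x * sqrt s"
  proof (intro mult_mono)
    show "L2_set d S \<le> x"
      unfolding x_def L2_set_def using fin SJ by (intro real_sqrt_le_mono sum_mono2) auto
    show "L2_set (\<lambda>_. 1) S \<le> sqrt s"
      using cardS by (simp add: L2_set_def)
  qed (use x in auto)
  finally have dS: "dS \<le> x * sqrt s" .
  have "G\<^sup>2 \<le> lam / 2 * (dS + dU) + lam * (dS - dU + 2 * r)"
  proof -
    have "(\<Sum>j\<in>J. \<bar>t j\<bar>) - (\<Sum>j\<in>J. \<bar>t j + d j\<bar>) \<le> dS - dU + 2 * r"
      using l1_penalty_decrease[OF fin SJ, of t d] tail by (simp add: dS_def dU_def)
    then have "lam * ((\<Sum>j\<in>J. \<bar>t j\<bar>) - (\<Sum>j\<in>J. \<bar>t j + d j\<bar>)) \<le> lam * (dS - dU + 2 * r)"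
      using lam by (intro mult_left_mono) auto
    then show ?thesis using basic by (simp add: dJ)
  qed
  then have G2: "G\<^sup>2 \<le> lam * (3 / 2 * dS - dU / 2 + 2 * r)"
    by (simp add: field_simps)
  \<comment> \<open>A square is nonnegative, so the right side is too; this gives the cone condition
    that bounds the error off \<open>S\<close> by the error on \<open>S\<close> plus the
    tail.\<close>
  then have "0 \<le> lam * (3 / 2 * dS - dU / 2 + 2 * r)"
    by (meson order_trans zero_le_power2)
  then have "dU \<le> 3 * dS + 4 * r"
    using lam by (simp add: zero_le_mult_iff)
  then have "dS + dU \<le> 4 * (x * sqrt s) + 4 * r"
    using dS by simp
  then have "\<kappa> * (dS + dU) \<le> \<kappa> * (4 * (x * sqrt s) + 4 * r)"
    using \<kappa> by (rule mult_left_mono)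
  \<comment> \<open>By \<open>small\<close>, the part \<open>4 * \<kappa> * sqrt s * x\<close> of
    the l1 term costs at most half of the curvature \<open>k * x\<close>.\<close>
  moreover have "8 * \<kappa> * sqrt s * x \<le> k * x"
    using small x by (intro mult_right_mono) (auto simp: s_def)
  ultimately have lower: "k / 2 * x - 4 * \<kappa> * r \<le> G"
    using curv unfolding dJ x_def[symmetric] by (simp add: algebra_simps)
  have nonneg: "0 \<le> (16 * \<kappa> / k)\<^sup>2 * r\<^sup>2" "0 \<le> 576 * lam\<^sup>2 * s / k ^ 4" "0 \<le> 64 * lam * r / k\<^sup>2"
    using s r lam k by auto
  have "x\<^sup>2 \<le> (16 * \<kappa> / k)\<^sup>2 * r\<^sup>2 + 576 * lam\<^sup>2 * s / k ^ 4 + 64 * lam * r / k\<^sup>2"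
  \<comment> \<open>Either the residual \<open>4 * \<kappa> * r\<close> already bounds
    \<open>x\<close>, or it consumes less than half of \<open>k / 2 * x\<close> and
    \<open>k / 4 * x\<close> remains below \<open>G\<close>.\<close>
  proof (cases "k / 4 * x \<le> 4 * \<kappa> * r")
    case True
    then have "x \<le> 16 * \<kappa> / k * r" using k by (simp add: field_simps)
    then have "x\<^sup>2 \<le> (16 * \<kappa> / k * r)\<^sup>2" using x by (rule power_mono)
    then show ?thesis using nonneg by (simp only: power_mult_distrib[of "16 * \<kappa> / k" r])
  next
    case False
    then have "k / 4 * x \<le> G" using lower by simp
    then have "(k / 4 * x)\<^sup>2 \<le> G\<^sup>2" using k x by (intro power_mono) auto
    also have "\<dots> \<le> lam * (3 / 2 * (x * sqrt s) + 2 * r)"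
    proof (rule order_trans[OF G2], rule mult_left_mono)
      show "3 / 2 * dS - dU / 2 + 2 * r \<le> 3 / 2 * (x * sqrt s) + 2 * r"
        using dS dU by simp
    qed (use lam in simp)
    finally have "k\<^sup>2 / 16 * x\<^sup>2 \<le> (3 / 2 * lam * sqrt s) * x + 2 * lam * r"
      by (simp add: power_mult_distrib power_divide algebra_simps)
    then have "x\<^sup>2 \<le> (3 / 2 * lam * sqrt s)\<^sup>2 / (k\<^sup>2 / 16)\<^sup>2 + 2 * (2 * lam * r) / (k\<^sup>2 / 16)"
      using k by (intro quadratic_inequality_bound) auto
    also have "\<dots> = 576 * lam\<^sup>2 * s / k ^ 4 + 64 * lam * r / k\<^sup>2"
      using s k by (simp add: power_mult_distrib power_divide power2_eq_square power4_eq_xxxx)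
    finally show ?thesis using nonneg by linarith
  qed
  then show ?thesis by (simp add: x_def s_def r_def)
qed

text \<open>
  The factor of \<open>\<surd>e\<close> in \<open>\<tau>\<close>, chosen so that the \<open>\<ell>\<^sub>1\<close> term of the curvature bound, restricted to the
  coordinates above \<open>\<tau>\<close>, costs at most half of \<open>k\<^sub>1\<close>.
\<close>

definition lasso_threshold :: "real \<Rightarrow> real \<Rightarrow> real \<Rightarrow> real \<Rightarrow> real" where
  "lasso_threshold q k\<^sub>1 k\<^sub>2 c = (64 * k\<^sub>2\<^sup>2 / (c * k\<^sub>1\<^sup>2)) powr (1 / q)"

text \<open>The summands match those of \<open>lasso_error_bound\<close> after division by
  \<open>R * e powr (1 - q / 2)\<close>. Here \<open>L\<close> is the penalty level in units of
  \<open>sqrt e\<close>, and \<tau> is the threshold in the same units.\<close>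

definition lasso_constant :: "real \<Rightarrow> real \<Rightarrow> real \<Rightarrow> real \<Rightarrow> real \<Rightarrow> real" where
  "lasso_constant q k\<^sub>1 k\<^sub>2 c L = (let \<tau> = lasso_threshold q k\<^sub>1 k\<^sub>2 c in
     256 * k\<^sub>2\<^sup>2 / (k\<^sub>1\<^sup>2 * c) * (\<tau> powr (1 - q))\<^sup>2
     + 576 * L\<^sup>2 / k\<^sub>1 ^ 4 * \<tau> powr (- q) + 64 * L / k\<^sub>1\<^sup>2 * \<tau> powr (1 - q))"

lemma lasso_constant_pos:
  assumes "0 < q" "0 < k\<^sub>1" "0 < k\<^sub>2" "0 < c" "0 < L"
  shows "0 < lasso_constant q k\<^sub>1 k\<^sub>2 c L"
  using assms unfolding lasso_constant_def Let_def lasso_threshold_def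
  by (intro add_pos_pos mult_pos_pos divide_pos_pos) auto

text \<open>Here \<open>e\<close> stands for \<open>ln p / T\<close> and \<open>m\<close> for
  \<open>ln p / n\<close>. A threshold proportional to \<open>sqrt e\<close>, the order of the
  penalty, brings all three terms of \<open>lasso_error_bound\<close> to the order
  \<open>R * e powr (1 - q / 2)\<close>.\<close>

lemma lasso_rate:
  fixes t d :: "'a \<Rightarrow> real"
  assumes fin: "finite J" and q: "0 < q" "q \<le> 1" and R: "0 < R" and e: "0 < e" and L: "0 < L"
    and k: "0 < k\<^sub>1" "0 < k\<^sub>2" and c: "0 < c" and m: "0 < m" and G: "0 \<le> G"
    and sparse: "(\<Sum>j\<in>J. \<bar>t j\<bar> powr q) \<le> R"
    and basic: "G\<^sup>2 \<le> L * sqrt e / 2 * (\<Sum>j\<in>J. \<bar>d j\<bar>)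
      + L * sqrt e * ((\<Sum>j\<in>J. \<bar>t j\<bar>) - (\<Sum>j\<in>J. \<bar>t j + d j\<bar>))"
    and curv: "k\<^sub>1 * L2_set d J - k\<^sub>2 * sqrt m * (\<Sum>j\<in>J. \<bar>d j\<bar>) \<le> G"
    and size: "m * (R * e powr (- q / 2)) \<le> 1 / c"
  shows "(L2_set d J)\<^sup>2 \<le> lasso_constant q k\<^sub>1 k\<^sub>2 c L * R * e powr (1 - q / 2)"
proof -
  define \<sigma> where "\<sigma> = lasso_threshold q k\<^sub>1 k\<^sub>2 c"
  define \<tau> where "\<tau> = \<sigma> * sqrt e"
  have \<sigma>: "0 < \<sigma>" using k c by (simp add: \<sigma>_def lasso_threshold_def)
  have \<sigma>q: "\<sigma> powr (- q) = c * k\<^sub>1\<^sup>2 / (64 * k\<^sub>2\<^sup>2)"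
    using q k c by (simp add: \<sigma>_def lasso_threshold_def powr_powr powr_minus)
  have \<tau>: "0 < \<tau>" using \<sigma> e by (simp add: \<tau>_def)
  have \<tau>q: "\<tau> powr (- q) = \<sigma> powr (- q) * e powr (- q / 2)"
    using \<sigma> e by (simp add: \<tau>_def powr_mult powr_half_sqrt[symmetric] powr_powr)
  have \<tau>q': "\<tau> powr (1 - q) = \<sigma> powr (1 - q) * e powr (1 / 2 - q / 2)"
    using \<sigma> e by (simp add: \<tau>_def powr_mult powr_half_sqrt[symmetric] powr_powr diff_divide_distrib)
  have small: "8 * (k\<^sub>2 * sqrt m) * sqrt (R * \<tau> powr (- q)) \<le> k\<^sub>1"
  proof (rule power2_le_imp_le)
    have "(8 * (k\<^sub>2 * sqrt m) * sqrt (R * \<tau> powr (- q)))\<^sup>2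
        = 64 * k\<^sub>2\<^sup>2 * \<sigma> powr (- q) * (m * (R * e powr (- q / 2)))"
      using m R by (simp add: power_mult_distrib \<tau>q)
    also have "\<dots> \<le> 64 * k\<^sub>2\<^sup>2 * \<sigma> powr (- q) * (1 / c)"
      by (intro mult_left_mono size) simp
    also have "\<dots> = k\<^sub>1\<^sup>2" using k c by (simp add: \<sigma>q)
    finally show "(8 * (k\<^sub>2 * sqrt m) * sqrt (R * \<tau> powr (- q)))\<^sup>2 \<le> k\<^sub>1\<^sup>2" .
  qed (use k in simp)
  let ?E = "R * e powr (1 - q / 2)"
  have "(L2_set d J)\<^sup>2 \<le> (16 * (k\<^sub>2 * sqrt m) / k\<^sub>1)\<^sup>2 * (R * \<tau> powr (1 - q))\<^sup>2
    + 576 * (L * sqrt e)\<^sup>2 * (R * \<tau> powr (- q)) / k\<^sub>1 ^ 4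
    + 64 * (L * sqrt e) * (R * \<tau> powr (1 - q)) / k\<^sub>1\<^sup>2"
    by (rule lasso_error_bound[OF fin q \<tau> _ _ k(1) G sparse basic curv small])
      (use L e k m in auto)
  also have "(16 * (k\<^sub>2 * sqrt m) / k\<^sub>1)\<^sup>2 * (R * \<tau> powr (1 - q))\<^sup>2
    \<le> 256 * k\<^sub>2\<^sup>2 / (k\<^sub>1\<^sup>2 * c) * (\<sigma> powr (1 - q))\<^sup>2 * ?E"
  proof -
    \<comment> \<open>This term is quadratic in \<open>R\<close>. Splitting off one factor
      \<open>R * e powr (- q / 2)\<close> leaves the desired rate, and \<open>size\<close> bounds
      that factor times \<open>m\<close>.\<close>
    have "(e powr (1 / 2 - q / 2))\<^sup>2 = e powr (- q / 2) * e powr (1 - q / 2)"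
      using e by (simp add: power2_eq_square powr_add[symmetric])
    then have "(16 * (k\<^sub>2 * sqrt m) / k\<^sub>1)\<^sup>2 * (R * \<tau> powr (1 - q))\<^sup>2
      = 256 * k\<^sub>2\<^sup>2 / k\<^sub>1\<^sup>2 * (\<sigma> powr (1 - q))\<^sup>2 * ?E * (m * (R * e powr (- q / 2)))"
      using m by (simp add: power_mult_distrib power_divide \<tau>q' power2_eq_square[of R])
    also have "\<dots> \<le> 256 * k\<^sub>2\<^sup>2 / k\<^sub>1\<^sup>2 * (\<sigma> powr (1 - q))\<^sup>2 * ?E * (1 / c)"
      using R by (intro mult_left_mono size) auto
    finally show ?thesis by (simp add: mult_ac)
  qed
  also have "576 * (L * sqrt e)\<^sup>2 * (R * \<tau> powr (- q)) / k\<^sub>1 ^ 4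
    = 576 * L\<^sup>2 / k\<^sub>1 ^ 4 * \<sigma> powr (- q) * ?E"
  proof -
    have "e * e powr (- q / 2) = e powr (1 - q / 2)"
      using e powr_add[of e 1 "- q / 2"] by simp
    then show ?thesis using e by (simp add: power_mult_distrib \<tau>q mult_ac)
  qed
  also have "64 * (L * sqrt e) * (R * \<tau> powr (1 - q)) / k\<^sub>1\<^sup>2
    = 64 * L / k\<^sub>1\<^sup>2 * \<sigma> powr (1 - q) * ?E"
  proof -
    have "sqrt e * e powr (1 / 2 - q / 2) = e powr (1 - q / 2)"
      using e powr_add[of e "1 / 2" "1 / 2 - q / 2"] by (simp add: powr_half_sqrt)
    then show ?thesis by (simp add: \<tau>q' mult_ac)
  qed
  finally show ?thesis
    by (simp add: lasso_constant_def \<sigma>_def Let_def algebra_simps)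
qed

section \<open>Vectors, matrices and the lasso objective\<close>

lemma l2_norm_sq: "(l2_norm u)\<^sup>2 = (\<Sum>j<dim_vec u. (u $ j)\<^sup>2)"
  by (simp add: l2_norm_def L2_set_def sum_nonneg)

lemma l2_norm_eq_sqrt_scalar_prod: "l2_norm u = sqrt (u \<bullet> u)"
  by (simp add: l2_norm_def L2_set_def scalar_prod_def power2_eq_square lessThan_atLeast0)

lemma l2_norm_orthonormal:
  assumes D: "orthonormal_mat p D" and v: "v \<in> carrier_vec p"
  shows "l2_norm (D *\<^sub>v v) = l2_norm v"
proof -
  have Dc: "D \<in> carrier_mat p p" and DD: "transpose_mat D * D = 1\<^sub>m p"
    using D by (auto simp: orthonormal_mat_def)
  have "(D *\<^sub>v v) \<bullet> (D *\<^sub>v v) = (transpose_mat D *\<^sub>v (D *\<^sub>v v)) \<bullet> v"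
    using Dc v by (intro transpose_vec_mult_scalar[symmetric]) auto
  also have "transpose_mat D *\<^sub>v (D *\<^sub>v v) = (transpose_mat D * D) *\<^sub>v v"
    using Dc v by (intro assoc_mult_mat_vec[symmetric]) auto
  finally show ?thesis
    using v by (simp add: DD l2_norm_eq_sqrt_scalar_prod)
qed

text \<open>For square matrices the left inverse is also a right inverse.\<close>

lemma orthonormal_mult_transpose_vec:
  assumes D: "orthonormal_mat p D" and f: "f \<in> carrier_vec p"
  shows "D *\<^sub>v (transpose_mat D *\<^sub>v f) = f"
proof -
  have Dc: "D \<in> carrier_mat p p" and DD: "transpose_mat D * D = 1\<^sub>m p"
    using D by (auto simp: orthonormal_mat_def)
  have "D * transpose_mat D = 1\<^sub>m p"
    by (rule mat_mult_left_right_inverse[OF _ Dc DD]) (use Dc in simp)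
  moreover have "(D * transpose_mat D) *\<^sub>v f = D *\<^sub>v (transpose_mat D *\<^sub>v f)"
    using Dc f by (intro assoc_mult_mat_vec) auto
  ultimately show ?thesis using f by simp
qed

lemma mult_mat_vec_entry:
  assumes "A \<in> carrier_mat n p" "v \<in> carrier_vec p" "i < n"
  shows "(A *\<^sub>v v) $ i = (\<Sum>j<p. A $$ (i, j) * v $ j)"
  using assms by (simp add: scalar_prod_def lessThan_atLeast0)

lemma smult_mat_mult_vec_entry:
  assumes "B \<in> carrier_mat n p" "v \<in> carrier_vec p" "i < n"
  shows "((c \<cdot>\<^sub>m B) *\<^sub>v v) $ i = c * (B *\<^sub>v v) $ i"
  using assms by (simp add: scalar_prod_def sum_distrib_left mult.assoc)

lemma mult_mat_entry:
  assumes "A \<in> carrier_mat n m" "B \<in> carrier_mat m p" "i < n" "j < p"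
  shows "(A * B) $$ (i, j) = (\<Sum>l<m. A $$ (i, l) * B $$ (l, j))"
  using assms by (simp add: scalar_prod_def lessThan_atLeast0)

lemma sum_lessThan_split_first:
  fixes g :: "nat \<Rightarrow> 'b::comm_monoid_add"
  assumes "1 \<le> p"
  shows "(\<Sum>j<p. g j) = g 0 + (\<Sum>j=1..<p. g j)"
  using assms by (simp add: lessThan_atLeast0 sum.atLeast_Suc_lessThan)

lemma sum_lessThan_pred_Suc:
  fixes g :: "nat \<Rightarrow> 'b::comm_monoid_add"
  shows "(\<Sum>j<p - 1. g (Suc j)) = (\<Sum>j=1..<p. g j)"
  by (cases p) (simp_all add: lessThan_atLeast0 sum.shift_bounds_Suc_ivl[symmetric])

text \<open>Compare the objective at the minimiser with its value at the feasible point
  \<open>t\<close>. The cross term is an inner product of \<open>\<theta> - t\<close> with the noise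
  correlations, bounded coordinatewise; the factor \<open>2 * n / T\<close> times the noise level
  \<open>T * lam / (4 * n)\<close> gives \<open>lam / 2\<close>.\<close>

lemma lasso_basic_inequality:
  assumes A: "A \<in> carrier_mat n p" and D: "D \<in> carrier_mat p p" and y: "y \<in> carrier_vec n"
    and n: "1 \<le> n" and p: "1 \<le> p" and T: "0 < T"
    and est: "is_lasso_estimate n p T A D lam y \<theta>"
    and t: "t \<in> carrier_vec p" "t $ 0 = 1 / sqrt (real p)"
    and noise: "\<And>j. j \<in> {1..<p} \<Longrightarrow>
      \<bar>\<Sum>i<n. (A * D) $$ (i, j) * (y $ i - T * ((A * D) *\<^sub>v t) $ i)\<bar> \<le> T * lam / (4 * real n)"
  shows "real n * (\<Sum>i<n. (((A * D) *\<^sub>v (\<theta> - t)) $ i)\<^sup>2)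
    \<le> lam / 2 * (\<Sum>j=1..<p. \<bar>\<theta> $ j - t $ j\<bar>)
      + lam * ((\<Sum>j=1..<p. \<bar>t $ j\<bar>) - (\<Sum>j=1..<p. \<bar>\<theta> $ j\<bar>))"
proof -
  let ?B = "A * D" and ?J = "{1..<p}"
  define w where "w i = y $ i - T * (?B *\<^sub>v t) $ i" for i
  define g where "g i = (?B *\<^sub>v (\<theta> - t)) $ i" for i
  have B: "?B \<in> carrier_mat n p" using A D by simp
  have \<theta>: "\<theta> \<in> carrier_vec p" "\<theta> $ 0 = 1 / sqrt (real p)"
    and le: "lasso_objective n T A D lam y \<theta> \<le> lasso_objective n T A D lam y t"
    using est t by (auto simp: is_lasso_estimate_def is_arg_min_linorder)
  have obj: "lasso_objective n T A D lam y u
      = real n / T\<^sup>2 * (\<Sum>i<n. (y $ i - T * (?B *\<^sub>v u) $ i)\<^sup>2) + lam * (\<Sum>j<p. \<bar>u $ j\<bar>)"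
    if u: "u \<in> carrier_vec p" for u
  proof -
    have "((T \<cdot>\<^sub>m ?B) *\<^sub>v u) $ i = T * (?B *\<^sub>v u) $ i" if "i < n" for i
      by (rule smult_mat_mult_vec_entry[OF B u that])
    then show ?thesis
      using u y A by (simp add: lasso_objective_def l2_norm_sq l1_norm_def del: index_mult_mat_vec)
  qed
  have res: "y $ i - T * (?B *\<^sub>v \<theta>) $ i = w i - T * g i" if "i < n" for i
    unfolding w_def g_def mult_minus_distrib_mat_vec[OF B \<theta>(1) t(1)]
    using that A by (simp add: right_diff_distrib del: index_mult_mat_vec)
  have "real n / T\<^sup>2 * (\<Sum>i<n. (w i - T * g i)\<^sup>2) + lam * (\<Sum>j<p. \<bar>\<theta> $ j\<bar>)
      \<le> real n / T\<^sup>2 * (\<Sum>i<n. (w i)\<^sup>2) + lam * (\<Sum>j<p. \<bar>t $ j\<bar>)"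
    using le by (simp add: obj \<theta> t res w_def)
  moreover have "real n / T\<^sup>2 * (\<Sum>i<n. (w i - T * g i)\<^sup>2) = real n / T\<^sup>2 * (\<Sum>i<n. (w i)\<^sup>2)
      - 2 * real n / T * (\<Sum>i<n. w i * g i) + real n * (\<Sum>i<n. (g i)\<^sup>2)"
  proof -
    have expand: "(\<Sum>i<n. (w i - T * g i)\<^sup>2)
        = (\<Sum>i<n. (w i)\<^sup>2) - 2 * T * (\<Sum>i<n. w i * g i) + T\<^sup>2 * (\<Sum>i<n. (g i)\<^sup>2)"
      by (simp add: power2_diff sum.distrib sum_subtractf sum_distrib_left power_mult_distrib algebra_simps)
    show ?thesis
      unfolding expand using T by (simp add: field_simps power2_eq_square)
  qed
  \<comment> \<open>The constraint fixes coordinate \<open>0\<close> of both vectors to the same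
    value, so it cancels in the penalty, and below also in \<open>\<theta> - t\<close>.\<close>
  moreover have "(\<Sum>j<p. \<bar>t $ j\<bar>) - (\<Sum>j<p. \<bar>\<theta> $ j\<bar>)
      = (\<Sum>j\<in>?J. \<bar>t $ j\<bar>) - (\<Sum>j\<in>?J. \<bar>\<theta> $ j\<bar>)"
    using \<theta> t by (simp add: sum_lessThan_split_first[OF p])
  then have "lam * (\<Sum>j<p. \<bar>t $ j\<bar>) - lam * (\<Sum>j<p. \<bar>\<theta> $ j\<bar>)
      = lam * ((\<Sum>j\<in>?J. \<bar>t $ j\<bar>) - (\<Sum>j\<in>?J. \<bar>\<theta> $ j\<bar>))"
    by (simp add: right_diff_distrib[symmetric])
  ultimately have main: "real n * (\<Sum>i<n. (g i)\<^sup>2) \<le> 2 * real n / T * (\<Sum>i<n. w i * g i)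
      + lam * ((\<Sum>j\<in>?J. \<bar>t $ j\<bar>) - (\<Sum>j\<in>?J. \<bar>\<theta> $ j\<bar>))"
    by linarith
  have "(\<Sum>i<n. w i * g i) = (\<Sum>i<n. \<Sum>j\<in>?J. (\<theta> $ j - t $ j) * (?B $$ (i, j) * w i))"
  proof (rule sum.cong[OF refl])
    fix i assume "i \<in> {..<n}"
    then have "g i = (\<Sum>j<p. ?B $$ (i, j) * (\<theta> - t) $ j)"
      unfolding g_def using B \<theta> t by (intro mult_mat_vec_entry) auto
    also have "\<dots> = (\<Sum>j\<in>?J. ?B $$ (i, j) * (\<theta> $ j - t $ j))"
      using t \<theta> p by (simp add: sum_lessThan_split_first[OF p])
    finally show "w i * g i = (\<Sum>j\<in>?J. (\<theta> $ j - t $ j) * (?B $$ (i, j) * w i))"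
      by (simp add: sum_distrib_left mult_ac)
  qed
  also have "\<dots> = (\<Sum>j\<in>?J. (\<theta> $ j - t $ j) * (\<Sum>i<n. ?B $$ (i, j) * w i))"
    by (subst sum.swap) (simp add: sum_distrib_left)
  also have "\<dots> \<le> (\<Sum>j\<in>?J. \<bar>\<theta> $ j - t $ j\<bar> * (T * lam / (4 * real n)))"
  proof (rule sum_mono)
    fix j assume j: "j \<in> ?J"
    have "(\<theta> $ j - t $ j) * (\<Sum>i<n. ?B $$ (i, j) * w i)
        \<le> \<bar>\<theta> $ j - t $ j\<bar> * \<bar>\<Sum>i<n. ?B $$ (i, j) * w i\<bar>"
      by (simp add: abs_mult[symmetric])
    also have "\<dots> \<le> \<bar>\<theta> $ j - t $ j\<bar> * (T * lam / (4 * real n))"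
      using noise[OF j] by (intro mult_left_mono) (simp_all add: w_def)
    finally show "(\<theta> $ j - t $ j) * (\<Sum>i<n. ?B $$ (i, j) * w i)
        \<le> \<bar>\<theta> $ j - t $ j\<bar> * (T * lam / (4 * real n))" .
  qed
  also have "\<dots> = (\<Sum>j\<in>?J. \<bar>\<theta> $ j - t $ j\<bar>) * (T * lam / (4 * real n))"
    by (rule sum_distrib_right[symmetric])
  finally have "2 * real n / T * (\<Sum>i<n. w i * g i)
      \<le> 2 * real n / T * ((\<Sum>j\<in>?J. \<bar>\<theta> $ j - t $ j\<bar>) * (T * lam / (4 * real n)))"
    using T by (intro mult_left_mono) simp_all
  also have "\<dots> = lam / 2 * (\<Sum>j\<in>?J. \<bar>\<theta> $ j - t $ j\<bar>)"
    using T n by simp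
  finally show ?thesis using main by (simp add: g_def)
qed

section \<open>Removing the first column of the basis\<close>

lemma D_bar_mult_entry:
  assumes "A \<in> carrier_mat n p" "D \<in> carrier_mat p p" "i < n" "j < p - 1"
  shows "(A * D_bar D) $$ (i, j) = (A * D) $$ (i, Suc j)"
proof -
  have "D_bar D \<in> carrier_mat p (p - 1)" using assms by (simp add: D_bar_def)
  then have "(A * D_bar D) $$ (i, j) = (\<Sum>l<p. A $$ (i, l) * D_bar D $$ (l, j))"
    using assms by (intro mult_mat_entry) auto
  also have "\<dots> = (\<Sum>l<p. A $$ (i, l) * D $$ (l, Suc j))"
    using assms by (intro sum.cong) (auto simp: D_bar_def)
  also have "\<dots> = (A * D) $$ (i, Suc j)"
    using assms by (intro mult_mat_entry[symmetric]) auto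
  finally show ?thesis .
qed

text \<open>When \<open>d $ 0 = 0\<close>, dropping that entry changes neither the norms nor the
  image, since column \<open>0\<close> of \<open>A * D\<close> is multiplied by zero.\<close>

lemma D_bar_curvature:
  assumes A: "A \<in> carrier_mat n p" and D: "D \<in> carrier_mat p p" and p: "1 \<le> p"
    and d: "d \<in> carrier_vec p" "d $ 0 = 0"
    and curv: "\<And>x. x \<in> carrier_vec (p - 1) \<Longrightarrow> k * l2_norm x - \<kappa> * l1_norm x
      \<le> s * l2_norm ((A * D_bar D) *\<^sub>v x)"
  shows "k * L2_set (\<lambda>j. d $ j) {1..<p} - \<kappa> * (\<Sum>j=1..<p. \<bar>d $ j\<bar>)
    \<le> s * l2_norm ((A * D) *\<^sub>v d)"
proof -
  define x where "x = vec (p - 1) (\<lambda>j. d $ Suc j)"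
  have x: "x \<in> carrier_vec (p - 1)" by (simp add: x_def)
  have B: "A * D_bar D \<in> carrier_mat n (p - 1)" using A D by (auto simp: D_bar_def)
  have "l2_norm x = L2_set (\<lambda>j. d $ j) {1..<p}"
    using sum_lessThan_pred_Suc[of "\<lambda>j. (d $ j)\<^sup>2" p] by (simp add: l2_norm_def L2_set_def x_def)
  moreover have "l1_norm x = (\<Sum>j=1..<p. \<bar>d $ j\<bar>)"
    using sum_lessThan_pred_Suc[of "\<lambda>j. \<bar>d $ j\<bar>" p] by (simp add: l1_norm_def x_def)
  moreover have "(A * D_bar D) *\<^sub>v x = (A * D) *\<^sub>v d"
  proof (rule eq_vecI)
    fix i assume "i < dim_vec ((A * D) *\<^sub>v d)"
    then have i: "i < n" using A by simp
    have "((A * D_bar D) *\<^sub>v x) $ i = (\<Sum>j<p - 1. (A * D) $$ (i, Suc j) * d $ Suc j)"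
      unfolding mult_mat_vec_entry[OF B x i]
      by (intro sum.cong) (auto simp: D_bar_mult_entry[OF A D i] x_def simp del: index_mult_mat)
    also have "\<dots> = (\<Sum>j=1..<p. (A * D) $$ (i, j) * d $ j)"
      by (rule sum_lessThan_pred_Suc)
    also have "\<dots> = (\<Sum>j<p. (A * D) $$ (i, j) * d $ j)"
      by (simp add: sum_lessThan_split_first[OF p] d)
    also have "\<dots> = ((A * D) *\<^sub>v d) $ i"
      using A D d i by (intro mult_mat_vec_entry[symmetric]) auto
    finally show "((A * D_bar D) *\<^sub>v x) $ i = ((A * D) *\<^sub>v d) $ i" .
  qed (use A in simp)
  ultimately show ?thesis using curv[OF x] by simp
qed

text \<open>A nonnegative vector of unit l1 norm has entry sum \<open>1\<close>, so its product with
  the constant first column is known. Hence the true coefficient vector satisfies the lasso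
  constraint.\<close>

lemma F_class_coefficients:
  assumes D: "orthonormal_mat p D" and D0: "col D 0 = vec p (\<lambda>_. real p powr (-1/2))"
    and p: "1 \<le> p" and f: "f \<in> F_class p q D R"
  shows "(transpose_mat D *\<^sub>v f) $ 0 = 1 / sqrt (real p)"
    and "(\<Sum>j=1..<p. \<bar>(transpose_mat D *\<^sub>v f) $ j\<bar> powr q) \<le> R"
proof -
  have Dc: "D \<in> carrier_mat p p" using D by (simp add: orthonormal_mat_def)
  have fc: "f \<in> carrier_vec p" and "l1_norm f = 1" and "\<forall>j<p. 0 \<le> f $ j"
    and lq: "lq_norm_pow q (transpose_mat (D_bar D) *\<^sub>v f) \<le> R"
    using f by (auto simp: F_class_def)
  then have sum1: "(\<Sum>j<p. f $ j) = 1" by (simp add: l1_norm_def)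
  have "(transpose_mat D *\<^sub>v f) $ 0 = col D 0 \<bullet> f" using Dc p by simp
  also have "\<dots> = real p powr (-1/2) * (\<Sum>j<p. f $ j)"
    using fc by (simp add: D0 scalar_prod_def sum_distrib_left lessThan_atLeast0)
  also have "\<dots> = 1 / sqrt (real p)"
    by (simp add: sum1 powr_minus powr_half_sqrt inverse_eq_divide)
  finally show "(transpose_mat D *\<^sub>v f) $ 0 = 1 / sqrt (real p)" .
  have "(transpose_mat (D_bar D) *\<^sub>v f) $ j = (transpose_mat D *\<^sub>v f) $ Suc j" if "j < p - 1" for j
    using that Dc fc by (simp add: scalar_prod_def D_bar_def)
  then have "lq_norm_pow q (transpose_mat (D_bar D) *\<^sub>v f)
      = (\<Sum>j<p - 1. \<bar>(transpose_mat D *\<^sub>v f) $ Suc j\<bar> powr q)"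
    unfolding lq_norm_pow_def using Dc by (intro sum.cong) (auto simp: D_bar_def)
  then show "(\<Sum>j=1..<p. \<bar>(transpose_mat D *\<^sub>v f) $ j\<bar> powr q) \<le> R"
    using lq sum_lessThan_pred_Suc[of "\<lambda>j. \<bar>(transpose_mat D *\<^sub>v f) $ j\<bar> powr q" p] by simp
qed

section \<open>Columns and entries of the sensing matrix\<close>

lemma orthonormal_col_sum_eq_0:
  assumes D: "orthonormal_mat p D" and D0: "col D 0 = vec p (\<lambda>_. c)" and c: "c \<noteq> 0"
    and j: "0 < j" "j < p"
  shows "(\<Sum>l<p. D $$ (l, j)) = 0"
proof -
  have Dc: "D \<in> carrier_mat p p" and DD: "transpose_mat D * D = 1\<^sub>m p"
    using D by (auto simp: orthonormal_mat_def)
  have "0 = (transpose_mat D * D) $$ (0, j)" using j by (simp add: DD)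
  also have "\<dots> = col D 0 \<bullet> col D j" using Dc j by simp
  also have "\<dots> = c * (\<Sum>l<p. D $$ (l, j))"
    unfolding D0 using Dc j by (simp add: scalar_prod_def sum_distrib_left lessThan_atLeast0)
  finally show ?thesis using c by simp
qed

lemma l0_norm_unit_vec: "j < p \<Longrightarrow> l0_norm (unit_vec p j) = 1"
proof -
  assume "j < p"
  then have "{i. i < dim_vec (unit_vec p j) \<and> unit_vec p j $ i \<noteq> (0::real)} = {j}"
    by (auto split: if_splits)
  then show ?thesis by (simp add: l0_norm_def)
qed

text \<open>Column \<open>j\<close> is the image of the unit vector \<open>j\<close>, which is
  1-sparse, so the restricted bound applies to it.\<close>

lemma col_energy_bound:
  assumes B: "B \<in> carrier_mat n p" and j: "j < p" and K: "1 \<le> K"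
    and rip: "\<And>u. u \<in> carrier_vec p \<Longrightarrow> l0_norm u \<le> K \<Longrightarrow> (l2_norm (B *\<^sub>v u))\<^sup>2 \<le> c * (l2_norm u)\<^sup>2"
  shows "(\<Sum>i<n. (B $$ (i, j))\<^sup>2) \<le> c"
proof -
  have "(l2_norm (B *\<^sub>v unit_vec p j))\<^sup>2 \<le> c * (l2_norm (unit_vec p j))\<^sup>2"
    using K j by (intro rip) (simp_all add: l0_norm_unit_vec)
  moreover have "(l2_norm (B *\<^sub>v unit_vec p j))\<^sup>2 = (\<Sum>i<n. (B $$ (i, j))\<^sup>2)"
    using B j by (simp add: l2_norm_sq)
  moreover have "l2_norm (unit_vec p j) = 1"
    using j by (simp add: l2_norm_eq_sqrt_scalar_prod)
  ultimately show ?thesis by simp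
qed

text \<open>The shift moves the entries into an interval whose upper end is twice its lower end. For
  the Poisson rates this yields positivity from below and a variance bound from above.\<close>

lemma rescaled_entry_bounds:
  fixes a a\<^sub>l a\<^sub>u m :: real
  assumes "a\<^sub>l < a\<^sub>u" and m: "0 < m" and a: "a\<^sub>l / sqrt m \<le> a" "a \<le> a\<^sub>u / sqrt m"
  shows "1 / (2 * m) \<le> 1 / (2 * (a\<^sub>u - a\<^sub>l) * sqrt m) * (a + (a\<^sub>u - 2 * a\<^sub>l) / sqrt m)"
    and "1 / (2 * (a\<^sub>u - a\<^sub>l) * sqrt m) * (a + (a\<^sub>u - 2 * a\<^sub>l) / sqrt m) \<le> 1 / m"
proof -
  let ?r = "1 / (2 * (a\<^sub>u - a\<^sub>l) * sqrt m)"
  have r: "0 \<le> ?r" using assms by simp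
  have lo: "(a\<^sub>u - a\<^sub>l) / sqrt m \<le> a + (a\<^sub>u - 2 * a\<^sub>l) / sqrt m"
    using a(1) by (simp add: diff_divide_distrib)
  have hi: "a + (a\<^sub>u - 2 * a\<^sub>l) / sqrt m \<le> 2 * ((a\<^sub>u - a\<^sub>l) / sqrt m)"
    using a(2) by (simp add: diff_divide_distrib)
  have "1 / (2 * b * s) * (b / s) = 1 / (2 * (s * s))" if "b \<noteq> 0" for b s :: real
    using that by simp
  moreover have "a\<^sub>u - a\<^sub>l \<noteq> 0" using assms(1) by simp
  ultimately have eq: "?r * ((a\<^sub>u - a\<^sub>l) / sqrt m) = 1 / (2 * m)"
    using m by (metis real_sqrt_mult_self abs_of_pos)
  show "1 / (2 * m) \<le> ?r * (a + (a\<^sub>u - 2 * a\<^sub>l) / sqrt m)"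
    using mult_left_mono[OF lo r] unfolding eq .
  have "?r * (a + (a\<^sub>u - 2 * a\<^sub>l) / sqrt m) \<le> ?r * (2 * ((a\<^sub>u - a\<^sub>l) / sqrt m))"
    by (rule mult_left_mono[OF hi r])
  also have "\<dots> = 2 * (?r * ((a\<^sub>u - a\<^sub>l) / sqrt m))" by (rule mult.left_commute)
  also have "\<dots> = 1 / m" unfolding eq by simp
  finally show "?r * (a + (a\<^sub>u - 2 * a\<^sub>l) / sqrt m) \<le> 1 / m" .
qed

text \<open>The constant shift is annihilated by every column of \<open>D\<close> with entry sum
  zero.\<close>

lemma shifted_mat_mult_entry:
  assumes D: "orthonormal_mat p D" and D0: "col D 0 = vec p (\<lambda>_. z)" and z: "z \<noteq> 0"
    and A': "A' \<in> carrier_mat n p" and A: "A = c \<cdot>\<^sub>m (A' + b \<cdot>\<^sub>m ones_mat n p)"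
    and i: "i < n" and j: "0 < j" "j < p"
  shows "(A * D) $$ (i, j) = c * (A' * D) $$ (i, j)"
proof -
  have Dc: "D \<in> carrier_mat p p" using D by (simp add: orthonormal_mat_def)
  have Ac: "A \<in> carrier_mat n p" using A A' by (simp add: ones_mat_def)
  have "(A * D) $$ (i, j) = (\<Sum>l<p. A $$ (i, l) * D $$ (l, j))"
    by (rule mult_mat_entry[OF Ac Dc i j(2)])
  also have "\<dots> = (\<Sum>l<p. c * (A' $$ (i, l) * D $$ (l, j)) + c * b * D $$ (l, j))"
    using A' i by (intro sum.cong) (auto simp: A ones_mat_def algebra_simps)
  also have "\<dots> = c * (A' * D) $$ (i, j) + c * b * (\<Sum>l<p. D $$ (l, j))"
    by (simp add: sum.distrib sum_distrib_left mult_mat_entry[OF A' Dc i j(2)] del: index_mult_mat)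
  finally show ?thesis by (simp add: orthonormal_col_sum_eq_0[OF D D0 z j])
qed

section \<open>The Poisson lasso\<close>

text \<open>Rates at most \<open>T / n\<close> and column energies at most \<open>M / n\<close> give
  the variance proxy \<open>V = T * M / n\<^sup>2\<close>. The noise level is chosen so that
  \<open>t\<^sup>2 / (4 * V) = 2 * ln p\<close>, which leaves room for a union over
  \<open>p - 1\<close> columns.\<close>

lemma poisson_noise_bound:
  fixes B :: "nat \<Rightarrow> nat \<Rightarrow> real"
  assumes A: "A \<in> carrier_mat n p"
    and A_lo: "\<And>i j. i < n \<Longrightarrow> j < p \<Longrightarrow> 1 / (2 * real n) \<le> A $$ (i, j)"
    and A_hi: "\<And>i j. i < n \<Longrightarrow> j < p \<Longrightarrow> A $$ (i, j) \<le> 1 / real n"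
    and f: "f \<in> F_class p q D R"
    and n: "1 \<le> n" and p: "2 \<le> p" and T: "2 * real n * ln (real p) < T" and M: "0 < M"
    and B: "\<And>j. j \<in> {1..<p} \<Longrightarrow> (\<Sum>i<n. (B i j)\<^sup>2) \<le> M / real n"
  defines "\<mu> \<equiv> T \<cdot>\<^sub>v (A *\<^sub>v f)"
  shows "measure_pmf.prob (poisson_vec \<mu>)
    {y. \<exists>j\<in>{1..<p}. sqrt (8 * M * T * ln (real p)) / real n \<le> \<bar>\<Sum>i<n. B i j * (y $ i - \<mu> $ i)\<bar>}
    \<le> 2 / (real p - 1)"
proof -
  define t where "t = sqrt (8 * M * T * ln (real p)) / real n"
  define V where "V = T * M / (real n)\<^sup>2"
  have lnp: "0 < ln (real p)" using p by simp
  have T0: "0 < T" using T n lnp by (smt (verit) mult_nonneg_nonneg of_nat_0_le_iff)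
  have V: "0 < V" using T0 M n by (simp add: V_def)
  have t: "0 \<le> t" using T0 M lnp by (simp add: t_def)
  have t2: "t\<^sup>2 = 8 * M * T * ln (real p) / (real n)\<^sup>2"
    using T0 M lnp by (simp add: t_def power_divide)
  have dim: "dim_vec \<mu> = n" using A by (simp add: \<mu>_def)
  have fc: "f \<in> carrier_vec p" and f0: "\<And>j. j < p \<Longrightarrow> 0 \<le> f $ j" and f1: "(\<Sum>j<p. f $ j) = 1"
    using f by (auto simp: F_class_def l1_norm_def)
  have \<mu>: "0 < \<mu> $ i \<and> \<mu> $ i \<le> T / real n" if i: "i < n" for i
  proof -
    have Af: "(A *\<^sub>v f) $ i = (\<Sum>j<p. A $$ (i, j) * f $ j)"
      by (rule mult_mat_vec_entry[OF A fc i])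
    have "(\<Sum>j<p. 1 / (2 * real n) * f $ j) \<le> (\<Sum>j<p. A $$ (i, j) * f $ j)"
      using A_lo[OF i] f0 by (intro sum_mono mult_right_mono) auto
    moreover have "(\<Sum>j<p. A $$ (i, j) * f $ j) \<le> (\<Sum>j<p. 1 / real n * f $ j)"
      using A_hi[OF i] f0 by (intro sum_mono mult_right_mono) auto
    ultimately have "1 / (2 * real n) \<le> (A *\<^sub>v f) $ i" "(A *\<^sub>v f) $ i \<le> 1 / real n"
      unfolding Af sum_distrib_left[symmetric] f1 by simp_all
    moreover have "0 < 1 / (2 * real n)" using n by simp
    ultimately have "0 < (A *\<^sub>v f) $ i" "T * (A *\<^sub>v f) $ i \<le> T * (1 / real n)"
      using T0 by (linarith, intro mult_left_mono) auto
    moreover have "\<mu> $ i = T * (A *\<^sub>v f) $ i" using A i by (simp add: \<mu>_def)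
    ultimately show ?thesis using T0 by simp
  qed
  have "measure_pmf.prob (poisson_vec \<mu>)
      {y. \<exists>j\<in>{1..<p}. t \<le> \<bar>\<Sum>i<dim_vec \<mu>. B i j * (y $ i - \<mu> $ i)\<bar>}
    \<le> real (card {1..<p}) * (2 * exp (- t\<^sup>2 / (4 * V)))"
  proof (rule poisson_vec_union_tail)
    fix j assume j: "j \<in> {1..<p}"
    have "(\<Sum>i<n. \<mu> $ i * (B i j)\<^sup>2) \<le> (\<Sum>i<n. T / real n * (B i j)\<^sup>2)"
      using \<mu> by (intro sum_mono mult_right_mono) auto
    also have "\<dots> \<le> T / real n * (M / real n)"
      unfolding sum_distrib_left[symmetric] using B[OF j] T0 by (intro mult_left_mono) auto
    finally show "(\<Sum>i<dim_vec \<mu>. \<mu> $ i * (B i j)\<^sup>2) \<le> V"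
      by (simp add: dim V_def power2_eq_square)
  next
    fix i j assume i: "i < dim_vec \<mu>" and j: "j \<in> {1..<p}"
    \<comment> \<open>A single entry is bounded by the energy of its column.\<close>
    have "(B i j)\<^sup>2 \<le> (\<Sum>i<n. (B i j)\<^sup>2)"
      using i by (intro member_le_sum) (auto simp: dim)
    then have "(B i j)\<^sup>2 \<le> M / real n" using B[OF j] by simp
    then have "t\<^sup>2 * (B i j)\<^sup>2 \<le> t\<^sup>2 * (M / real n)"
      by (intro mult_left_mono) auto
    \<comment> \<open>The factor \<open>2 * n * ln p\<close> is isolated; replacing it by the larger
      \<open>T\<close> gives exactly \<open>(2 * V)\<^sup>2\<close>.\<close>
    also have "\<dots> = 4 * T * M\<^sup>2 / (real n)\<^sup>2 ^ 2 * (2 * real n * ln (real p))"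
      unfolding t2 using n by (simp add: field_simps power2_eq_square)
    also have "\<dots> \<le> 4 * T * M\<^sup>2 / (real n)\<^sup>2 ^ 2 * T"
      using T T0 M by (intro mult_left_mono) auto
    also have "\<dots> = (2 * V)\<^sup>2"
      by (simp add: V_def power2_eq_square)
    finally have "(t * \<bar>B i j\<bar>)\<^sup>2 \<le> (2 * V)\<^sup>2" by (simp add: power_mult_distrib)
    then show "t * \<bar>B i j\<bar> \<le> 2 * V"
      by (rule power2_le_imp_le) (use V in simp)
  qed (use \<mu> dim V t in auto)
  also have "- t\<^sup>2 / (4 * V) = - (2 * ln (real p))"
    using T0 M n by (simp add: t2 V_def)
  also have "exp (- (2 * ln (real p))) = 1 / (real p)\<^sup>2"
    using p by (simp add: exp_minus exp_double inverse_eq_divide)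
  also have "real (card {1..<p}) * (2 * (1 / (real p)\<^sup>2)) \<le> 2 / (real p - 1)"
  proof -
    have "(real p - 1)\<^sup>2 \<le> (real p)\<^sup>2" using p by (intro power_mono) auto
    then show ?thesis using p by (simp add: of_nat_diff field_simps power2_eq_square)
  qed
  finally show ?thesis by (simp add: dim t_def)
qed

text \<open>The deterministic statement for one observation whose noise is small. It instantiates
  \<open>lasso_rate\<close> on the coordinates from \<open>1\<close> on and transfers the
  coefficient error to \<open>f\<close> by orthonormality.\<close>

lemma lasso_estimate_rate:
  assumes q: "0 < q" "q \<le> 1" and R: "0 < R" and L: "0 < L" and k: "0 < k\<^sub>1" "0 < k\<^sub>2" and c: "0 < c"
    and n: "1 \<le> n" and p: "2 \<le> p" and T: "0 < T"
    and A: "A \<in> carrier_mat n p" and D: "orthonormal_mat p D"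
    and D0: "col D 0 = vec p (\<lambda>_. real p powr (-1/2))"
    and f: "f \<in> F_class p q D R" and y: "y \<in> carrier_vec n"
    and est: "is_lasso_estimate n p T A D (L * sqrt (ln (real p) / T)) y \<theta>"
    and noise: "\<And>j. j \<in> {1..<p} \<Longrightarrow>
      \<bar>\<Sum>i<n. (A * D) $$ (i, j) * (y $ i - (T \<cdot>\<^sub>v (A *\<^sub>v f)) $ i)\<bar>
        \<le> T * (L * sqrt (ln (real p) / T)) / (4 * real n)"
    and curv: "\<And>x. x \<in> carrier_vec (p - 1) \<Longrightarrow>
      k\<^sub>1 * l2_norm x - k\<^sub>2 * sqrt (ln (real p) / real n) * l1_norm x
        \<le> sqrt (real n) * l2_norm ((A * D_bar D) *\<^sub>v x)"
    and size: "ln (real p) / real n * (R * (ln (real p) / T) powr (- q / 2)) \<le> 1 / c"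
  shows "(l2_norm (D *\<^sub>v \<theta> - f))\<^sup>2
    \<le> lasso_constant q k\<^sub>1 k\<^sub>2 c L * R * (ln (real p) / T) powr (1 - q / 2)"
proof -
  define t where "t = transpose_mat D *\<^sub>v f"
  define d where "d = \<theta> - t"
  let ?J = "{1..<p}" and ?e = "ln (real p) / T"
  let ?G = "sqrt (real n) * l2_norm ((A * D) *\<^sub>v d)"
  have p1: "1 \<le> p" using p by simp
  have lnp: "0 < ln (real p)" using p by simp
  have Dc: "D \<in> carrier_mat p p" using D by (simp add: orthonormal_mat_def)
  have fc: "f \<in> carrier_vec p" using f by (simp add: F_class_def)
  have tc: "t \<in> carrier_vec p" 
    unfolding t_def by (rule mult_mat_vec_carrier[OF _ fc]) (use Dc in simp)
  have \<theta>: "\<theta> \<in> carrier_vec p" "\<theta> $ 0 = 1 / sqrt (real p)"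
    using est by (auto simp: is_lasso_estimate_def is_arg_min_def)
  have Dt: "D *\<^sub>v t = f" unfolding t_def by (rule orthonormal_mult_transpose_vec[OF D fc])
  have t0: "t $ 0 = 1 / sqrt (real p)" and sparse: "(\<Sum>j\<in>?J. \<bar>t $ j\<bar> powr q) \<le> R"
    unfolding t_def using F_class_coefficients[OF D D0 p1 f] by auto
  have dc: "d \<in> carrier_vec p" and d0: "d $ 0 = 0"
    using \<theta> tc t0 p1 by (auto simp: d_def)
  have d: "d $ j = \<theta> $ j - t $ j" if "j \<in> ?J" for j
    using that tc by (simp add: d_def)
  have ADt: "(A * D) *\<^sub>v t = A *\<^sub>v f"
    using assoc_mult_mat_vec[OF A Dc tc] by (simp add: Dt)
  have "real n * (\<Sum>i<n. (((A * D) *\<^sub>v (\<theta> - t)) $ i)\<^sup>2)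
    \<le> L * sqrt ?e / 2 * (\<Sum>j=1..<p. \<bar>\<theta> $ j - t $ j\<bar>)
      + L * sqrt ?e * ((\<Sum>j=1..<p. \<bar>t $ j\<bar>) - (\<Sum>j=1..<p. \<bar>\<theta> $ j\<bar>))"
  proof (rule lasso_basic_inequality[OF A Dc y n p1 T est tc t0])
    fix j assume j: "j \<in> ?J"
    have "(\<Sum>i<n. (A * D) $$ (i, j) * (y $ i - T * ((A * D) *\<^sub>v t) $ i))
        = (\<Sum>i<n. (A * D) $$ (i, j) * (y $ i - (T \<cdot>\<^sub>v (A *\<^sub>v f)) $ i))"
      unfolding ADt using A by (intro sum.cong) auto
    then show "\<bar>\<Sum>i<n. (A * D) $$ (i, j) * (y $ i - T * ((A * D) *\<^sub>v t) $ i)\<bar>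
        \<le> T * (L * sqrt ?e) / (4 * real n)"
      using noise[OF j] by simp
  qed
  moreover have "?G\<^sup>2 = real n * (\<Sum>i<n. (((A * D) *\<^sub>v d) $ i)\<^sup>2)"
    using A by (simp add: power_mult_distrib l2_norm_sq del: index_mult_mat_vec)
  ultimately have basic: "?G\<^sup>2 \<le> L * sqrt ?e / 2 * (\<Sum>j\<in>?J. \<bar>d $ j\<bar>)
      + L * sqrt ?e * ((\<Sum>j\<in>?J. \<bar>t $ j\<bar>) - (\<Sum>j\<in>?J. \<bar>t $ j + d $ j\<bar>))"
    by (simp add: d_def[symmetric] d)
  have "k\<^sub>1 * L2_set (\<lambda>j. d $ j) ?J - k\<^sub>2 * sqrt (ln (real p) / real n) * (\<Sum>j\<in>?J. \<bar>d $ j\<bar>) \<le> ?G"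
    by (rule D_bar_curvature[OF A Dc p1 dc d0 curv])
  then have "(L2_set (\<lambda>j. d $ j) ?J)\<^sup>2
      \<le> lasso_constant q k\<^sub>1 k\<^sub>2 c L * R * ?e powr (1 - q / 2)"
    by (intro lasso_rate[OF _ q R _ L k c _ _ sparse basic _ size])
      (use lnp T n in \<open>auto simp: l2_norm_def\<close>)
  also have "(L2_set (\<lambda>j. d $ j) ?J)\<^sup>2 = (l2_norm d)\<^sup>2"
    using dc d0 by (simp add: l2_norm_sq sum_lessThan_split_first[OF p1] L2_set_def sum_nonneg)
  also have "l2_norm d = l2_norm (D *\<^sub>v d)"
    by (rule l2_norm_orthonormal[OF D dc, symmetric])
  also have "D *\<^sub>v d = D *\<^sub>v \<theta> - f"
    unfolding d_def using mult_minus_distrib_mat_vec[OF Dc \<theta>(1) tc] by (simp add: Dt)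
  finally show ?thesis .
qed

text \<open>The estimator may be any selection of minimisers on the support; as the law is a
  \<open>pmf\<close>, every set of observations is an event.\<close>

theorem theorem2:
  fixes q a\<^sub>l a\<^sub>u \<delta> c\<^sub>0 c\<^sub>K C\<^sub>K k\<^sub>1 k\<^sub>2 :: real
  assumes "0 < q" "q \<le> 1"
    and "a\<^sub>l < a\<^sub>u"
    and "0 < \<delta>" "\<delta> < 1"
    and "0 < c\<^sub>0"
    and "0 < c\<^sub>K" "0 < C\<^sub>K"
    and "0 < k\<^sub>1" "0 < k\<^sub>2"
  shows "\<exists>C\<^sub>U>0.
    \<forall>(R::real) (n::nat) (p::nat) (T::real) (D::real mat) (f::real vec) (A::real mat)
      (A'::real mat) (K::nat) (\<theta>::real vec \<Rightarrow> real vec).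
      0 < R \<and> 1 \<le> n \<and> 2 \<le> p \<and> 0 < T \<longrightarrow>
      orthonormal_mat p D \<and> col D 0 = vec p (\<lambda>_. real p powr (-1/2)) \<longrightarrow>
      f \<in> F_class p q D R \<longrightarrow>
      T > 2 * real n * ln (real p) \<longrightarrow>
      1 \<le> K \<and>
        c\<^sub>K * R * (ln (real p) / T) powr (- q / 2) \<le> real K \<and>
        real K \<le> C\<^sub>K * R * (ln (real p) / T) powr (- q / 2) \<longrightarrow>
      A' \<in> carrier_mat n p \<and>
        (\<forall>i<n. \<forall>j<p. A' $$ (i, j) \<in> {a\<^sub>l / sqrt (real n) .. a\<^sub>u / sqrt (real n)}) \<and>
        A = (1 / (2 * (a\<^sub>u - a\<^sub>l) * sqrt (real n))) \<cdot>\<^sub>m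
              (A' + ((a\<^sub>u - 2 * a\<^sub>l) / sqrt (real n)) \<cdot>\<^sub>m ones_mat n p) \<longrightarrow>
      (\<forall>u \<in> carrier_vec p. l0_norm u \<le> 2 * K \<longrightarrow>
        (l2_norm ((A' * D) *\<^sub>v u))^2 \<le> (1 + \<delta>) * (l2_norm u)^2) \<longrightarrow>
      real n \<ge> c\<^sub>0 * real K * ln (real p) \<longrightarrow>
      (\<forall>x \<in> carrier_vec (p - 1).
        sqrt (real n) * l2_norm ((A * D_bar D) *\<^sub>v x)
          \<ge> k\<^sub>1 * l2_norm x - k\<^sub>2 * sqrt (ln (real p) / real n) * l1_norm x) \<longrightarrow>
      (let M = (1 + \<delta>) / (4 * (a\<^sub>u - a\<^sub>l)^2);
           lam = 2 * sqrt (32 * M * ln (real p) / T);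
           P = poisson_vec (T \<cdot>\<^sub>v (A *\<^sub>v f))
       in (\<forall>y \<in> set_pmf P. is_lasso_estimate n p T A D lam y (\<theta> y)) \<longrightarrow>
          measure_pmf.prob P
            {y. (l2_norm (D *\<^sub>v \<theta> y - f))^2 \<le> C\<^sub>U * R * (ln (real p) / T) powr (1 - q / 2)}
          \<ge> 1 - 2 / (real p - 1))"
proof -
  define M where "M = (1 + \<delta>) / (4 * (a\<^sub>u - a\<^sub>l)\<^sup>2)"
  \<comment> \<open>The penalty level divided by \<open>sqrt (ln p / T)\<close>.\<close>
  define L where "L = 2 * sqrt (32 * M)"
  define C\<^sub>U where "C\<^sub>U = lasso_constant q k\<^sub>1 k\<^sub>2 (c\<^sub>0 * c\<^sub>K) L"
  have M: "0 < M" using assms by (simp add: M_def)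
  have L: "0 < L" using M by (simp add: L_def)
  have c: "0 < c\<^sub>0 * c\<^sub>K" using assms by simp
  have bound: "1 - 2 / (real p - 1) \<le> measure_pmf.prob (poisson_vec (T \<cdot>\<^sub>v (A *\<^sub>v f)))
      {y. (l2_norm (D *\<^sub>v \<theta> y - f))\<^sup>2 \<le> C\<^sub>U * R * (ln (real p) / T) powr (1 - q / 2)}"
    if R: "0 < R" and n: "1 \<le> n" and p: "2 \<le> p" and T0: "0 < T"
      and D: "orthonormal_mat p D" and D0: "col D 0 = vec p (\<lambda>_. real p powr (-1/2))"
      and f: "f \<in> F_class p q D R" and T: "2 * real n * ln (real p) < T"
      and K: "1 \<le> K" "c\<^sub>K * R * (ln (real p) / T) powr (- q / 2) \<le> real K"
      and A': "A' \<in> carrier_mat n p"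
      and entries: "\<forall>i<n. \<forall>j<p. A' $$ (i, j) \<in> {a\<^sub>l / sqrt (real n) .. a\<^sub>u / sqrt (real n)}"
      and A: "A = (1 / (2 * (a\<^sub>u - a\<^sub>l) * sqrt (real n))) \<cdot>\<^sub>m
              (A' + ((a\<^sub>u - 2 * a\<^sub>l) / sqrt (real n)) \<cdot>\<^sub>m ones_mat n p)"
      and rip: "\<forall>u \<in> carrier_vec p. l0_norm u \<le> 2 * K \<longrightarrow>
        (l2_norm ((A' * D) *\<^sub>v u))\<^sup>2 \<le> (1 + \<delta>) * (l2_norm u)\<^sup>2"
      and size: "c\<^sub>0 * real K * ln (real p) \<le> real n"
      and curv: "\<forall>x \<in> carrier_vec (p - 1).
        k\<^sub>1 * l2_norm x - k\<^sub>2 * sqrt (ln (real p) / real n) * l1_norm x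
          \<le> sqrt (real n) * l2_norm ((A * D_bar D) *\<^sub>v x)"
      and est: "\<forall>y \<in> set_pmf (poisson_vec (T \<cdot>\<^sub>v (A *\<^sub>v f))).
        is_lasso_estimate n p T A D (2 * sqrt (32 * M * ln (real p) / T)) y (\<theta> y)"
    for R n p T D f A A' K \<theta>
  proof -
    let ?P = "poisson_vec (T \<cdot>\<^sub>v (A *\<^sub>v f))" and ?e = "ln (real p) / T"
    let ?X = "\<lambda>j y. \<Sum>i<n. (A * D) $$ (i, j) * (y $ i - (T \<cdot>\<^sub>v (A *\<^sub>v f)) $ i)"
    let ?t = "sqrt (8 * M * T * ln (real p)) / real n"
    let ?bad = "{y. \<exists>j\<in>{1..<p}. ?t \<le> \<bar>?X j y\<bar>}"
    let ?good = "{y. (l2_norm (D *\<^sub>v \<theta> y - f))\<^sup>2 \<le> C\<^sub>U * R * ?e powr (1 - q / 2)}"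
    have lnp: "0 < ln (real p)" using p by simp
    have Ac: "A \<in> carrier_mat n p" using A A' by (simp add: ones_mat_def)
    have Dc: "D \<in> carrier_mat p p" using D by (simp add: orthonormal_mat_def)
    have lam: "2 * sqrt (32 * M * ln (real p) / T) = L * sqrt ?e"
      by (simp add: L_def real_sqrt_mult real_sqrt_divide)
    have A_entry: "A $$ (i, j) = 1 / (2 * (a\<^sub>u - a\<^sub>l) * sqrt (real n))
        * (A' $$ (i, j) + (a\<^sub>u - 2 * a\<^sub>l) / sqrt (real n))" if "i < n" "j < p" for i j
      using that A' by (simp add: A ones_mat_def)
    have A_bounds: "1 / (2 * real n) \<le> A $$ (i, j)" "A $$ (i, j) \<le> 1 / real n"
      if "i < n" "j < p" for i j
      unfolding A_entry[OF that]
      by (rule rescaled_entry_bounds[OF assms(3)]; use that entries n in simp)+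
    \<comment> \<open>The shift drops out, and the squared scale
      \<open>1 / (4 * (a\<^sub>u - a\<^sub>l)\<^sup>2 * n)\<close> turns the column energy
      \<open>1 + \<delta>\<close> of \<open>A' * D\<close> into \<open>M / n\<close>.\<close>
    have energy: "(\<Sum>i<n. ((A * D) $$ (i, j))\<^sup>2) \<le> M / real n" if j: "j \<in> {1..<p}" for j
    proof -
      have "(\<Sum>i<n. ((A * D) $$ (i, j))\<^sup>2)
          = (\<Sum>i<n. (1 / (2 * (a\<^sub>u - a\<^sub>l) * sqrt (real n)) * (A' * D) $$ (i, j))\<^sup>2)"
      proof (rule sum.cong[OF refl])
        fix i assume "i \<in> {..<n}"
        then show "((A * D) $$ (i, j))\<^sup>2
            = (1 / (2 * (a\<^sub>u - a\<^sub>l) * sqrt (real n)) * (A' * D) $$ (i, j))\<^sup>2"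
          using j p by (subst shifted_mat_mult_entry[OF D D0 _ A' A]) auto
      qed
      also have "\<dots> = 1 / (4 * (a\<^sub>u - a\<^sub>l)\<^sup>2 * real n) * (\<Sum>i<n. ((A' * D) $$ (i, j))\<^sup>2)"
        by (simp only: power_mult_distrib sum_distrib_left[symmetric]) 
          (simp add: power_divide power_mult_distrib del: right_diff_distrib_numeral)
      also have "\<dots> \<le> 1 / (4 * (a\<^sub>u - a\<^sub>l)\<^sup>2 * real n) * (1 + \<delta>)"
      proof (rule mult_left_mono)
        show "(\<Sum>i<n. ((A' * D) $$ (i, j))\<^sup>2) \<le> 1 + \<delta>"
          by (rule col_energy_bound[of _ n p j "2 * K"]) (use A' Dc j K rip in auto)
      qed simp
      finally show ?thesis by (simp add: M_def)
    qed
    have bad: "measure_pmf.prob ?P ?bad \<le> 2 / (real p - 1)"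
      by (rule poisson_noise_bound[OF Ac A_bounds f n p T M energy])
    \<comment> \<open>The sample size condition combined with the lower bound on \<open>K\<close>
      eliminates \<open>K\<close>; this is the origin of the constant
      \<open>c\<^sub>0 * c\<^sub>K\<close>.\<close>
    have size': "ln (real p) / real n * (R * ?e powr (- q / 2)) \<le> 1 / (c\<^sub>0 * c\<^sub>K)"
    proof -
      have "c\<^sub>0 * ln (real p) * (c\<^sub>K * R * ?e powr (- q / 2)) \<le> c\<^sub>0 * ln (real p) * real K"
        using K lnp assms by (intro mult_left_mono) auto
      then have "c\<^sub>0 * ln (real p) * (c\<^sub>K * R * ?e powr (- q / 2)) \<le> real n"
        using size by (simp add: mult_ac)
      moreover have "0 < real n" using n by simp
      ultimately show ?thesis using c by (simp only: pos_le_divide_eq) (simp add: field_simps)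
    qed
    have good: "y \<in> ?good" if y: "y \<in> set_pmf ?P" and ok: "y \<notin> ?bad" for y
    proof -
      have yc: "y \<in> carrier_vec n" using y Ac by (auto simp: poisson_vec_def)
      \<comment> \<open>The Chernoff level coincides with the noise level required by the basic
        inequality.\<close>
      have thr: "?t = T * (L * sqrt ?e) / (4 * real n)"
      proof -
        have "T * (L * sqrt ?e) / 4 = sqrt (8 * M * T * ln (real p))"
        proof (rule power2_eq_imp_eq)
          show "(T * (L * sqrt ?e) / 4)\<^sup>2 = (sqrt (8 * M * T * ln (real p)))\<^sup>2"
            using T0 M lnp by (simp add: L_def power_mult_distrib power_divide power2_eq_square[of T])
        qed (use T0 L M lnp in auto)
        then show ?thesis by (simp add: field_simps)
      qed
      show ?thesis
        unfolding C\<^sub>U_def mem_Collect_eq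
      proof (rule lasso_estimate_rate[OF assms(1,2) R L assms(9,10) c n p T0 Ac D D0 f yc _ _ _ size'])
        show "is_lasso_estimate n p T A D (L * sqrt ?e) y (\<theta> y)"
          using est y unfolding lam by blast
        show "\<bar>?X j y\<bar> \<le> T * (L * sqrt ?e) / (4 * real n)" if "j \<in> {1..<p}" for j
          using ok that unfolding thr by force
      qed (use curv in blast)
    qed
    have "1 - 2 / (real p - 1) \<le> measure_pmf.prob ?P (- ?bad)"
      using bad measure_pmf.prob_compl[of ?bad ?P] by (simp add: Compl_eq_Diff_UNIV)
    \<comment> \<open>Minimality and the dimension of \<open>y\<close> are known on the support, so
      the event is first restricted to it.\<close>
    also have "\<dots> = measure_pmf.prob ?P (- ?bad \<inter> set_pmf ?P)"
      by (rule measure_Int_set_pmf[symmetric])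
    also have "\<dots> \<le> measure_pmf.prob ?P ?good"
      using good by (intro measure_pmf.finite_measure_mono) auto
    finally show ?thesis .
  qed
  show ?thesis
  proof (intro exI[of _ C\<^sub>U] conjI)
    show "0 < C\<^sub>U" unfolding C\<^sub>U_def using assms c L by (intro lasso_constant_pos)
  qed (unfold Let_def M_def[symmetric], intro allI impI, elim conjE, rule bound; assumption)
qed

end
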